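(* Let $T>0$, $\sigma>0$, and let $\mathcal X_t=\mathcal Y_t+\sigma\mathcal Z_t$, $0\le t\le T$, where $\mathcal Z$ is an $\alpha$-stable Lévy process with $1<\alpha<2$, which is $1/\alpha$-self-similar, and let $\Psi$ be the distribution function of $\mathcal Z_1$. Suppose that for some $1\le p<\alpha$, $$\limsup_{n\to\infty}\sum_{k=1}^n\big|\mathcal Y_{Tk/n}-\mathcal Y_{T(k-1)/n}\big|^p<\infty\quad\text{with probability one.}$$ Let $\bm X=(X_1,\dots,X_n)$ with $X_k=(T/n)^{-1/\alpha}(\mathcal X_{Tk/n}-\mathcal X_{T(k-1)/n})$. Let $r\in\{1,2\}$, let $\bm\psi$ be either the deterministic or the random proxy (defined in the context), and let $\bm w=\omega(\bm\psi)$, where $\omega:\mathbb{R}\to[0,1]$ is continuous and satisfies $$\sup_{x\in\mathbb{R}}|x|^{2r}\omega(x)<\infty\qquad\text{and}\qquad\mathbb{E}[|\mathcal Z_1|^r\omega(\mathcal Z_1)]>0.$$ Then the estimator $\Sigma_r$ is consistent (i.e. $\Sigma_r\to\sigma$ in probability as $n\to\infty$) and satisfies $$|\Sigma_r-\sigma|=O_{\mathbb P}\big(n^{1/\alpha-1/p}\big).$$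
   Context: $1/\alpha$-self-similar means $(\mathcal Z_{ct})_{t\ge0}$ and $(c^{1/\alpha}\mathcal Z_t)_{t\ge0}$ have the same finite-dimensional distributions for every $c>0$ (strict stability). $\Psi^{-1}(u)=\inf\{x:\Psi(x)\ge u\}$. $\bm x^{\uparrow}$ is the non-decreasing rearrangement of $\bm x\in\mathbb{R}^n$; functions of vectors are applied coordinatewise. Deterministic proxy: $\psi_k=\Psi^{-1}(k/(n+1))$, $1\le k\le n$. Random proxy: $\bm\psi=\bm\xi^{\uparrow}$, where $\bm\xi$ is an auxiliary i.i.d. sample of size $n$ with distribution function $\Psi$, generated independently of the data $\bm X$ and of $\mathcal Z$. The estimator $\Sigma_r$ is a minimizer over $s\in\mathbb{R}$ of $\sum_{k=1}^n w_k|X_k^{\uparrow}-s\psi_k|^r$. No assumption is made on the dependence between $\mathcal Y$ and $\mathcal Z$. $\zeta_n=O_{\mathbb P}(\beta_n)$ means that $\zeta_n/\beta_n$ is bounded in probability (tight) as $n\to\infty$. *)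

theory Defs
  imports "HOL-Probability.Probability"
begin

section \<open>Stable Levy processes\<close>

text \<open>Processes are families indexed by real times; only times \<open>t \<ge> 0\<close> are meaningful.\<close>

definition levy_process :: "'a measure \<Rightarrow> (real \<Rightarrow> 'a \<Rightarrow> real) \<Rightarrow> bool" where
  "levy_process M Z \<longleftrightarrow>
     (\<forall>t\<ge>0. Z t \<in> borel_measurable M) \<and>
     (AE x in M. Z 0 x = 0) \<and>
     (\<forall>(m::nat) (\<tau>::nat \<Rightarrow> real). 0 \<le> \<tau> 0 \<and> (\<forall>i<m. \<tau> i \<le> \<tau> (Suc i)) \<longrightarrow>
        prob_space.indep_vars M (\<lambda>_. borel) (\<lambda>i x. Z (\<tau> (Suc i)) x - Z (\<tau> i) x) {..<m}) \<and>
     (\<forall>s\<ge>0. \<forall>t\<ge>0. distr M borel (\<lambda>x. Z (s + t) x - Z s x) = distr M borel (Z t)) \<and>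
     (\<forall>t\<ge>0. \<forall>\<epsilon>>0.
        ((\<lambda>s. measure M {x \<in> space M. \<bar>Z s x - Z t x\<bar> > \<epsilon>}) \<longlongrightarrow> 0) (at t within {0..})) \<and>
     (AE x in M. \<forall>t\<ge>0. continuous (at_right t) (\<lambda>s. Z s x) \<and>
        (t > 0 \<longrightarrow> (\<exists>l. ((\<lambda>s. Z s x) \<longlongrightarrow> l) (at_left t))))"

text \<open>A non-degenerate law \<open>\<mu>\<close> such that, for independent \<open>U\<close>, \<open>V\<close> with law \<open>\<mu>\<close> and \<open>a, b > 0\<close>,
  the variable \<open>a U + b V\<close> has the law of \<open>c U + d\<close> for some \<open>d\<close>, where
  \<open>c\<close> is determined by \<open>c powr \<alpha> = a powr \<alpha> + b powr \<alpha>\<close>.\<close>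

definition stable_distribution :: "real \<Rightarrow> real measure \<Rightarrow> bool" where
  "stable_distribution \<alpha> \<mu> \<longleftrightarrow>
     real_distribution \<mu> \<and> (\<forall>x. \<mu> \<noteq> return borel x) \<and>
     (\<forall>a>0. \<forall>b>0. \<exists>d.
        distr (\<mu> \<Otimes>\<^sub>M \<mu>) borel (\<lambda>(u, v). a * u + b * v) =
        distr \<mu> borel (\<lambda>u. (a powr \<alpha> + b powr \<alpha>) powr (1 / \<alpha>) * u + d))"

definition stable_levy_process :: "'a measure \<Rightarrow> real \<Rightarrow> (real \<Rightarrow> 'a \<Rightarrow> real) \<Rightarrow> bool" where
  "stable_levy_process M \<alpha> Z \<longleftrightarrow>
     levy_process M Z \<and> stable_distribution \<alpha> (distr M borel (Z 1))"

definition same_fdd :: "'a measure \<Rightarrow> (real \<Rightarrow> 'a \<Rightarrow> real) \<Rightarrow> (real \<Rightarrow> 'a \<Rightarrow> real) \<Rightarrow> bool" where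
  "same_fdd M U V \<longleftrightarrow>
     (\<forall>J. finite J \<and> J \<subseteq> {0..} \<longrightarrow>
        distr M (Pi\<^sub>M J (\<lambda>_. borel)) (\<lambda>x. \<lambda>t\<in>J. U t x) =
        distr M (Pi\<^sub>M J (\<lambda>_. borel)) (\<lambda>x. \<lambda>t\<in>J. V t x))"

definition self_similar :: "'a measure \<Rightarrow> real \<Rightarrow> (real \<Rightarrow> 'a \<Rightarrow> real) \<Rightarrow> bool" where
  "self_similar M h Z \<longleftrightarrow>
     (\<forall>c>0. same_fdd M (\<lambda>t. Z (c * t)) (\<lambda>t x. c powr h * Z t x))"

section \<open>Order statistics, proxies and the estimator\<close>

text \<open>Samples of size \<open>n\<close> are functions on the indices \<open>1, \<dots>, n\<close>.\<close>

definition order_stat :: "nat \<Rightarrow> (nat \<Rightarrow> real) \<Rightarrow> nat \<Rightarrow> real" where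
  "order_stat n v k = sort (map v [1..<Suc n]) ! (k - 1)"

definition quantile :: "(real \<Rightarrow> real) \<Rightarrow> real \<Rightarrow> real" where
  "quantile F u = Inf {x. F x \<ge> u}"

definition scaled_increment ::
    "real \<Rightarrow> real \<Rightarrow> (real \<Rightarrow> 'a \<Rightarrow> real) \<Rightarrow> nat \<Rightarrow> nat \<Rightarrow> 'a \<Rightarrow> real" where
  "scaled_increment \<alpha> T P n k x =
     (T / real n) powr (- 1 / \<alpha>) * (P (T * real k / real n) x - P (T * (real k - 1) / real n) x)"

definition deterministic_proxy :: "(real \<Rightarrow> real) \<Rightarrow> (nat \<Rightarrow> nat \<Rightarrow> 'a \<Rightarrow> real) \<Rightarrow> bool" where
  "deterministic_proxy \<Psi> \<psi> \<longleftrightarrow>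
     (\<forall>n\<ge>1. \<forall>k\<in>{1..n}. \<forall>x. \<psi> n k x = quantile \<Psi> (real k / (real n + 1)))"

text \<open>For each \<open>n\<close>, the auxiliary sample \<open>\<xi> n 1, \<dots>, \<xi> n n\<close> is i.i.d. and, as a vector, independent
  of the pair formed by the data vector \<open>X n\<close> and the whole process \<open>Z\<close>. Nothing is assumed about
  the relation between the samples for different \<open>n\<close>.\<close>

definition random_proxy ::
    "'a measure \<Rightarrow> (nat \<Rightarrow> nat \<Rightarrow> 'a \<Rightarrow> real) \<Rightarrow> (real \<Rightarrow> 'a \<Rightarrow> real) \<Rightarrow> (real \<Rightarrow> real)
      \<Rightarrow> (nat \<Rightarrow> nat \<Rightarrow> 'a \<Rightarrow> real) \<Rightarrow> bool" where
  "random_proxy M X Z \<Psi> \<psi> \<longleftrightarrow>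
     (\<exists>\<xi> :: nat \<Rightarrow> nat \<Rightarrow> 'a \<Rightarrow> real. \<forall>n\<ge>1.
        prob_space.indep_vars M (\<lambda>_. borel) (\<xi> n) {1..n} \<and>
        (\<forall>k\<in>{1..n}. cdf (distr M borel (\<xi> n k)) = \<Psi>) \<and>
        prob_space.indep_set M
          (sets (vimage_algebra (space M) (\<lambda>x. \<lambda>k\<in>{1..n}. \<xi> n k x) (Pi\<^sub>M {1..n} (\<lambda>_. borel))))
          (sets (vimage_algebra (space M) (\<lambda>x. (\<lambda>k\<in>{1..n}. X n k x, \<lambda>t\<in>{0..}. Z t x))
             (Pi\<^sub>M {1..n} (\<lambda>_. borel) \<Otimes>\<^sub>M Pi\<^sub>M {0..} (\<lambda>_. borel)))) \<and>
        (\<forall>k\<in>{1..n}. \<forall>x\<in>space M. \<psi> n k x = order_stat n (\<lambda>j. \<xi> n j x) k))"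

definition scale_objective ::
    "nat \<Rightarrow> (real \<Rightarrow> real) \<Rightarrow> nat \<Rightarrow> (nat \<Rightarrow> real) \<Rightarrow> (nat \<Rightarrow> real) \<Rightarrow> real \<Rightarrow> real" where
  "scale_objective r \<omega> n v q s =
     (\<Sum>k=1..n. \<omega> (q k) * \<bar>order_stat n v k - s * q k\<bar> ^ r)"

text \<open>Minimizers need not be unique; any random variable selecting one is admitted.\<close>

definition scale_estimator ::
    "'a measure \<Rightarrow> nat \<Rightarrow> (real \<Rightarrow> real) \<Rightarrow> (nat \<Rightarrow> nat \<Rightarrow> 'a \<Rightarrow> real) \<Rightarrow> (nat \<Rightarrow> nat \<Rightarrow> 'a \<Rightarrow> real)
      \<Rightarrow> (nat \<Rightarrow> 'a \<Rightarrow> real) \<Rightarrow> bool" where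
  "scale_estimator M r \<omega> X \<psi> S \<longleftrightarrow>
     (\<forall>n. S n \<in> borel_measurable M) \<and>
     (\<forall>n\<ge>1. \<forall>x\<in>space M.
        is_arg_min (scale_objective r \<omega> n (\<lambda>k. X n k x) (\<lambda>k. \<psi> n k x)) (\<lambda>_. True) (S n x))"

section \<open>Stochastic orders\<close>

definition tendsto_in_prob :: "'a measure \<Rightarrow> (nat \<Rightarrow> 'a \<Rightarrow> real) \<Rightarrow> real \<Rightarrow> bool" where
  "tendsto_in_prob M S c \<longleftrightarrow>
     (\<forall>\<epsilon>>0. (\<lambda>n. measure M {x \<in> space M. \<bar>S n x - c\<bar> > \<epsilon>}) \<longlonglongrightarrow> 0)"

definition bigo_in_prob :: "'a measure \<Rightarrow> (nat \<Rightarrow> 'a \<Rightarrow> real) \<Rightarrow> (nat \<Rightarrow> real) \<Rightarrow> bool" where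
  "bigo_in_prob M S \<beta> \<longleftrightarrow> tight (\<lambda>n. distr M borel (\<lambda>x. S n x / \<beta> n))"

end

theory Submission
  imports Defs
begin

text \<open>Put \<open>\<zeta>\<^sub>k\<close> for the rescaled increments of \<open>Z\<close>, which are i.i.d. with law \<open>\<Psi>\<close>, and
  \<open>D = (1/n) \<Sum>\<^sub>k \<bar>X\<^sub>k\<^sup>\<up> - \<sigma> \<psi>\<^sub>k\<bar>\<close>. Minimality of the estimator (the triangle inequality for \<open>r = 1\<close>, the
  normal equation and boundedness of \<open>\<bar>x\<bar> \<omega>(x)\<close> for \<open>r = 2\<close>) gives
  \<open>\<bar>S - \<sigma>\<bar> (1/n) \<Sum>\<^sub>k \<omega>(\<psi>\<^sub>k) \<bar>\<psi>\<^sub>k\<bar> ^ r \<le> C D\<close>, and the sum on the left stays away from \<open>0\<close>.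
  Sorting contracts the \<open>l\<^sub>1\<close>-distance, so replacing \<open>X\<close> by \<open>\<sigma> \<zeta>\<close> in \<open>D\<close> costs at most the mean
  absolute rescaled increment of \<open>Y\<close>, which is \<open>O(n powr (1/\<alpha> - 1/p))\<close>. The remaining term
  \<open>(1/n) \<Sum>\<^sub>k \<bar>\<zeta>\<^sub>k\<^sup>\<up> - \<psi>\<^sub>k\<bar>\<close> is the integral of the difference of two empirical distribution functions. Each
  deviates from \<open>\<Psi>\<close> by at most \<open>min (2 v(x)) (sqrt (v(x) / n))\<close> in mean, where \<open>v = min \<Psi> (1 - \<Psi>)\<close>
  satisfies \<open>v(x) \<le> C \<bar>x\<bar> powr - \<alpha>\<close> by stability, and this integrates to
  \<open>O(n powr (1/\<alpha> - 1))\<close>, which is negligible because \<open>p \<ge> 1\<close>.\<close>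

section \<open>Order statistics and empirical distribution functions\<close>

text \<open>Sorting permutes the list, so both sums run over the same multiset. The shift between
  \<open>k\<close> and \<open>k - 1\<close> only matches list positions from 0 with sample indices
  from 1.\<close>

lemma sum_order_stat:
  "(\<Sum>k=1..n. f (order_stat n v k)) = (\<Sum>k=1..n. f (v k) :: 'b :: comm_monoid_add)"
proof -
  define xs where "xs = map v [1..<Suc n]"
  have "(\<Sum>k=1..n. f (order_stat n v k)) = (\<Sum>i<n. f (sort xs ! i))"
    unfolding order_stat_def xs_def[symmetric]
    by (rule sum.reindex_bij_witness[of _ Suc "\<lambda>k. k - 1"]) auto
  also have "\<dots> = sum_list (map f (sort xs))"
    by (subst sum_list_sum_nth) (auto simp: xs_def atLeast0LessThan simp del: upt_Suc)
  also have "\<dots> = sum_list (map f xs)"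
    by (metis mset_map mset_sort sum_mset_sum_list)
  also have "\<dots> = (\<Sum>k=1..n. f (v k))"
    by (simp add: xs_def o_def interv_sum_list_conv_sum_set_nat atLeastLessThanSuc_atLeastAtMost del: upt_Suc)
  finally show ?thesis .
qed

lemma mono_on_order_stat: "mono_on {1..n} (order_stat n v)"
  unfolding order_stat_def by (rule mono_onI) (auto intro!: sorted_nth_mono)

text \<open>A factor \<open>c\<close> \<ge> 0 preserves the order, so the scaled sorted list is
  still sorted; a negative factor would reverse it.\<close>

lemma order_stat_cmult:
  assumes "0 \<le> c" "k \<in> {1..n}"
  shows "order_stat n (\<lambda>j. c * v j) k = c * order_stat n v k"
proof -
  define xs where "xs = map v [1..<Suc n]"
  have "sort (map ((*) c) xs) = map ((*) c) (sort xs)"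
    using \<open>0 \<le> c\<close>
    by (intro properties_for_sort) (auto simp: sorted_map intro!: mult_left_mono sorted_wrt_mono_rel[OF _ sorted_sort])
  moreover have eq: "map (\<lambda>j. c * v j) [1..<Suc n] = map ((*) c) xs"
    by (simp add: xs_def)
  moreover have "k - 1 < length (sort xs)"
    using \<open>k \<in> {1..n}\<close> by (auto simp: xs_def)
  ultimately show ?thesis
    unfolding order_stat_def eq xs_def[symmetric] by simp
qed

definition ecdf :: "nat \<Rightarrow> (nat \<Rightarrow> real) \<Rightarrow> real \<Rightarrow> real" where
  "ecdf n a x = (\<Sum>k=1..n. of_bool (a k \<le> x)) / real n"

text \<open>For distribution functions this is the Wasserstein distance of order 1 between the laws.
  With values in \<open>ennreal\<close>, it can be estimated and averaged before anything is known
  to be integrable.\<close>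

definition cdf_dist :: "(real \<Rightarrow> real) \<Rightarrow> (real \<Rightarrow> real) \<Rightarrow> ennreal" where
  "cdf_dist F G = (\<integral>\<^sup>+x. ennreal \<bar>F x - G x\<bar> \<partial>lborel)"

lemma ecdf_measurable [measurable]: "ecdf n a \<in> borel_measurable borel"
  unfolding ecdf_def[abs_def] by measurable

lemma ecdf_order_stat: "ecdf n (order_stat n v) = ecdf n v"
  unfolding ecdf_def[abs_def]
  by (subst sum_order_stat[of "\<lambda>a. of_bool (a \<le> _)"]) (rule refl)

lemma ecdf_nonneg: "0 \<le> ecdf n a x"
  unfolding ecdf_def by (auto intro!: divide_nonneg_nonneg sum_nonneg)

lemma ecdf_le_1: "ecdf n a x \<le> 1"
proof -
  have "(\<Sum>k=1..n. of_bool (a k \<le> x)) \<le> (\<Sum>k=1..n. 1::real)"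
    by (intro sum_mono) auto
  then show ?thesis
    unfolding ecdf_def by (simp add: divide_le_eq)
qed

lemma cdf_dist_triangle:
  assumes [measurable]: "F \<in> borel_measurable borel" "G \<in> borel_measurable borel" "H \<in> borel_measurable borel"
  shows "cdf_dist F G \<le> cdf_dist F H + cdf_dist G H"
proof -
  have "cdf_dist F G \<le> (\<integral>\<^sup>+x. ennreal \<bar>F x - H x\<bar> + ennreal \<bar>G x - H x\<bar> \<partial>lborel)"
    unfolding cdf_dist_def
    by (intro nn_integral_mono) (auto simp flip: ennreal_plus intro!: ennreal_leI)
  also have "\<dots> = cdf_dist F H + cdf_dist G H"
    unfolding cdf_dist_def by (rule nn_integral_add) auto
  finally show ?thesis .
qed

text \<open>The integrand is the indicator of the interval from \<open>min u v\<close> to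
  \<open>max u v\<close>. This identity converts distances between sample points into integrals over
  distribution functions.\<close>

lemma nn_integral_of_bool_diff:
  "(\<integral>\<^sup>+x. ennreal \<bar>of_bool (u \<le> x) - of_bool (v \<le> x)\<bar> \<partial>lborel) = ennreal \<bar>u - v\<bar>"
proof -
  have "(\<integral>\<^sup>+x. ennreal \<bar>of_bool (u \<le> x) - of_bool (v \<le> x)\<bar> \<partial>lborel)
    = (\<integral>\<^sup>+x. indicator {min u v..<max u v} x \<partial>lborel)"
    by (intro nn_integral_cong) (auto simp: indicator_def)
  also have "\<dots> = ennreal \<bar>u - v\<bar>"
    by (auto simp: min_def max_def)
  finally show ?thesis .
qed

lemma sum_nn_integral_of_bool_diff:
  assumes "finite I"
  shows "(\<integral>\<^sup>+x. ennreal ((\<Sum>k\<in>I. \<bar>of_bool (u k \<le> x) - of_bool (v k \<le> x)\<bar>) / c) \<partial>lborel)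
    = ennreal ((\<Sum>k\<in>I. \<bar>u k - v k\<bar>) / c)"
proof (cases "c \<le> 0")
  \<comment> \<open>Both quotients are nonpositive here (zero if \<open>c = 0\<close>), and
    \<open>ennreal\<close> sends them to 0; this covers the empty sample.\<close>
  case True
  then have "(\<Sum>k\<in>I. \<bar>u k - v k\<bar>) / c \<le> 0"
    and "(\<Sum>k\<in>I. \<bar>of_bool (u k \<le> x) - of_bool (v k \<le> x)\<bar>) / c \<le> 0" for x :: real
    by (auto intro!: divide_nonneg_nonpos sum_nonneg)
  then show ?thesis by (simp add: ennreal_neg)
next
  case False
  then have "(\<integral>\<^sup>+x. ennreal ((\<Sum>k\<in>I. \<bar>of_bool (u k \<le> x) - of_bool (v k \<le> x)\<bar>) / c) \<partial>lborel)
    = (\<integral>\<^sup>+x. ennreal (1 / c) * (\<Sum>k\<in>I. ennreal \<bar>of_bool (u k \<le> x) - of_bool (v k \<le> x)\<bar>) \<partial>lborel)"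
    by (intro nn_integral_cong, subst sum_ennreal)
      (auto simp: sum_nonneg simp flip: ennreal_mult)
  also have "\<dots> = ennreal (1 / c) * (\<Sum>k\<in>I. ennreal \<bar>u k - v k\<bar>)"
    by (subst nn_integral_cmult, measurable, subst nn_integral_sum) (auto simp: nn_integral_of_bool_diff)
  also have "\<dots> = ennreal ((\<Sum>k\<in>I. \<bar>u k - v k\<bar>) / c)"
    using False by (subst sum_ennreal) (auto simp: sum_nonneg simp flip: ennreal_mult)
  finally show ?thesis .
qed

lemma ecdf_diff:
  "ecdf n u x - ecdf n v x = (\<Sum>k=1..n. of_bool (u k \<le> x) - of_bool (v k \<le> x)) / real n"
  unfolding ecdf_def by (simp add: sum_subtractf diff_divide_distrib)

text \<open>The triangle inequality under the integral, for the pairing of \<open>u k\<close> with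
  \<open>v k\<close>. An arbitrary pairing gives an upper bound only, because terms of opposite sign
  may cancel on the left.\<close>

lemma cdf_dist_ecdf_le:
  "cdf_dist (ecdf n u) (ecdf n v) \<le> ennreal ((\<Sum>k=1..n. \<bar>u k - v k\<bar>) / real n)"
  unfolding cdf_dist_def ecdf_diff
  by (subst sum_nn_integral_of_bool_diff[OF finite_atLeastAtMost, symmetric], intro nn_integral_mono ennreal_leI) (auto simp: abs_divide intro!: divide_right_mono sum_abs)

text \<open>The monotone pairing is optimal: no cancellation occurs, and the estimate of
  \<open>cdf_dist_ecdf_le\<close> becomes an equality.\<close>

lemma cdf_dist_ecdf_mono:
  assumes u: "mono_on {1..n} u" and v: "mono_on {1..n} v"
  shows "cdf_dist (ecdf n u) (ecdf n v) = ennreal ((\<Sum>k=1..n. \<bar>u k - v k\<bar>) / real n)"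
  unfolding cdf_dist_def ecdf_diff
proof (subst sum_nn_integral_of_bool_diff[OF finite_atLeastAtMost, symmetric], intro nn_integral_cong)
  fix x :: real
  let ?d = "\<lambda>k. of_bool (u k \<le> x) - of_bool (v k \<le> x) :: real"
  \<comment> \<open>The indices \<open>k\<close> with \<open>u k \<le> x\<close> and those with \<open>v k \<le> x\<close> are nested initial segments of
    \<open>{1..n}\<close>, so the differences all have the same sign.\<close>
  have "(\<forall>k\<in>{1..n}. 0 \<le> ?d k) \<or> (\<forall>k\<in>{1..n}. ?d k \<le> 0)"
  proof (rule ccontr)
    assume "\<not> ?thesis"
    then obtain i j where ij: "i \<in> {1..n}" "j \<in> {1..n}"
      and "\<not> u i \<le> x" "v i \<le> x" "u j \<le> x" "\<not> v j \<le> x"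
      by (auto simp: of_bool_def split: if_splits)
    then show False
      using mono_onD[OF u, of i j] mono_onD[OF u, of j i] mono_onD[OF v, of i j] mono_onD[OF v, of j i]
      by (cases "i \<le> j") auto
  qed
  then have "\<bar>\<Sum>k=1..n. ?d k\<bar> = (\<Sum>k=1..n. \<bar>?d k\<bar>)"
  proof
    assume "\<forall>k\<in>{1..n}. 0 \<le> ?d k"
    then show ?thesis
      by (subst abs_of_nonneg) (auto intro!: sum_nonneg sum.cong)
  next
    assume *: "\<forall>k\<in>{1..n}. ?d k \<le> 0"
    have "(\<Sum>k=1..n. ?d k) = - (\<Sum>k=1..n. \<bar>?d k\<bar>)"
      unfolding sum_negf[symmetric] by (intro sum.cong refl) (use * in auto)
    then show ?thesis
      by (simp only: abs_minus_cancel) (intro abs_of_nonneg sum_nonneg, auto)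
  qed
  then show "ennreal \<bar>(\<Sum>k=1..n. ?d k) / real n\<bar> = ennreal ((\<Sum>k=1..n. \<bar>?d k\<bar>) / real n)"
    by (simp add: abs_divide)
qed

text \<open>Sorting leaves the empirical distribution functions unchanged. The sorted pairing
  attains their distance, while the original pairing bounds it from above.\<close>

lemma sum_order_stat_diff_le:
  "(\<Sum>k=1..n. \<bar>order_stat n u k - order_stat n v k\<bar>) \<le> (\<Sum>k=1..n. \<bar>u k - v k\<bar>)"
proof (cases "n = 0")
  case False
  have "ennreal ((\<Sum>k=1..n. \<bar>order_stat n u k - order_stat n v k\<bar>) / real n)
    = cdf_dist (ecdf n u) (ecdf n v)"
    using cdf_dist_ecdf_mono[OF mono_on_order_stat mono_on_order_stat] by (metis ecdf_order_stat)
  also note cdf_dist_ecdf_le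
  finally show ?thesis
    using False by (subst (asm) ennreal_le_iff) (auto simp: sum_nonneg divide_le_cancel)
qed simp

section \<open>Stability of minimizers of the weighted objective\<close>

text \<open>The constant \<open>max 2 B\<close> serves both exponents. For \<open>r = 1\<close> the
  factor 2 comes from comparing the residuals at \<open>s\<close> and \<sigma> and using minimality;
  for \<open>r = 2\<close> the maximum dominates \<open>\<omega> x * \<bar>x\<bar>\<close>, which
  multiplies the residuals in the normal equation.\<close>

lemma sum_weight_abs_le:
  assumes r: "r \<in> {1, 2}"
    and \<omega>: "\<And>x. \<omega> x \<in> {0..1}" and B: "\<And>x. \<bar>x\<bar> ^ (2 * r) * \<omega> x \<le> B"
    and s: "is_arg_min (scale_objective r \<omega> n v q) (\<lambda>_. True) s"
  shows "\<bar>s - \<sigma>\<bar> * (\<Sum>k=1..n. \<omega> (q k) * \<bar>q k\<bar> ^ r)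
    \<le> max 2 B * (\<Sum>k=1..n. \<bar>order_stat n v k - \<sigma> * q k\<bar>)"
proof -
  define e where "e t k = order_stat n v k - t * q k" for t k
  have le: "scale_objective r \<omega> n v q s \<le> scale_objective r \<omega> n v q t" for t
    using s by (auto simp: is_arg_min_linorder)
  have \<omega>0: "0 \<le> \<omega> x" "\<omega> x \<le> 1" for x
    using \<omega>[of x] by auto
  show ?thesis
  proof (cases "r = 1")
    case True
    have obj: "scale_objective r \<omega> n v q t = (\<Sum>k=1..n. \<omega> (q k) * \<bar>e t k\<bar>)" for t
      unfolding scale_objective_def e_def True by simp
    have "\<bar>s - \<sigma>\<bar> * (\<Sum>k=1..n. \<omega> (q k) * \<bar>q k\<bar> ^ r) = (\<Sum>k=1..n. \<omega> (q k) * \<bar>e \<sigma> k - e s k\<bar>)"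
      unfolding sum_distrib_left
    proof (intro sum.cong refl)
      fix k
      have "e \<sigma> k - e s k = (s - \<sigma>) * q k" by (simp add: e_def algebra_simps)
      then show "\<bar>s - \<sigma>\<bar> * (\<omega> (q k) * \<bar>q k\<bar> ^ r) = \<omega> (q k) * \<bar>e \<sigma> k - e s k\<bar>"
        by (simp add: True abs_mult)
    qed
    also have "\<dots> \<le> (\<Sum>k=1..n. \<omega> (q k) * \<bar>e \<sigma> k\<bar> + \<omega> (q k) * \<bar>e s k\<bar>)"
      unfolding distrib_left[symmetric] by (intro sum_mono mult_left_mono \<omega>0) auto
    also have "\<dots> \<le> 2 * (\<Sum>k=1..n. \<omega> (q k) * \<bar>e \<sigma> k\<bar>)"
      using le[of \<sigma>] by (simp add: obj sum.distrib)
    also have "\<dots> \<le> 2 * (\<Sum>k=1..n. \<bar>e \<sigma> k\<bar>)"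
      by (intro mult_left_mono sum_mono mult_left_le_one_le) (auto simp: \<omega>0)
    also have "\<dots> \<le> max 2 B * (\<Sum>k=1..n. \<bar>e \<sigma> k\<bar>)"
      by (intro mult_right_mono) (auto intro!: sum_nonneg)
    finally show ?thesis by (simp add: e_def)
  next
    case False
    with r have r2: "r = 2" by simp
    define A where "A = (\<Sum>k=1..n. \<omega> (q k) * (q k)\<^sup>2)"
    define N where "N = (\<Sum>k=1..n. \<omega> (q k) * (q k * e s k))"
    have A0: "0 \<le> A" unfolding A_def by (intro sum_nonneg) (auto simp: \<omega>0)
    \<comment> \<open>The exact expansion of the quadratic objective about \<open>s\<close>;
      \<open>N\<close> is minus half its derivative there.\<close>
    have obj: "scale_objective r \<omega> n v q (s + h)
        = scale_objective r \<omega> n v q s - 2 * h * N + h\<^sup>2 * A" for h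
      unfolding scale_objective_def N_def A_def r2 sum_distrib_left
        sum.distrib[symmetric] sum_subtractf[symmetric]
      by (intro sum.cong refl) (simp add: e_def power2_eq_square algebra_simps)
    \<comment> \<open>The normal equation: otherwise the step \<open>N / A\<close> decreases the objective.\<close>
    have N: "N = 0" if "A \<noteq> 0"
    proof -
      have "0 \<le> - 2 * (N / A) * N + (N / A)\<^sup>2 * A"
        using le[of "s + N / A"] obj[of "N / A"] by simp
      also have "\<dots> = - (N\<^sup>2 / A)"
        using that by (simp add: power2_eq_square field_simps)
      finally have "N\<^sup>2 \<le> 0"
        using A0 that by (simp add: divide_le_0_iff)
      then show ?thesis by simp
    qed
    \<comment> \<open>Where \<open>\<bar>x\<bar>\<close> \<le> 1 the product is at most 1; elsewhere
      \<open>\<bar>x\<bar>\<close> is below its fourth power, which \<open>B\<close>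
      controls.\<close>
    have qw: "\<omega> x * \<bar>x\<bar> \<le> max 2 B" for x
    proof (cases "\<bar>x\<bar> \<le> 1")
      case True
      then have "\<omega> x * \<bar>x\<bar> \<le> 1 * 1" using \<omega>0 by (intro mult_mono) auto
      then show ?thesis by simp
    next
      case False
      then have "\<bar>x\<bar> ^ 1 \<le> \<bar>x\<bar> ^ (2 * r)"
        unfolding r2 by (intro power_increasing) auto
      then have "\<omega> x * \<bar>x\<bar> \<le> \<omega> x * \<bar>x\<bar> ^ (2 * r)"
        using \<omega>0 by (intro mult_left_mono) auto
      with B[of x] show ?thesis by (simp add: mult.commute)
    qed
    have "\<bar>s - \<sigma>\<bar> * A = \<bar>\<Sum>k=1..n. \<omega> (q k) * (q k * e \<sigma> k)\<bar>"
    proof (cases "A = 0")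
      \<comment> \<open>Every weighted square vanishes, so the objective does not depend on its
        argument; both sides are 0 for any \<open>s\<close>.\<close>
      case True
      have "\<omega> (q k) * (q k)\<^sup>2 = 0" if "k \<in> {1..n}" for k
        using True that \<omega>0 unfolding A_def by (subst (asm) sum_nonneg_eq_0_iff) auto
      then have "(\<Sum>k=1..n. \<omega> (q k) * (q k * e \<sigma> k)) = 0"
        by (intro sum.neutral ballI) fastforce
      with True show ?thesis by simp
    next
      case False
      have "(\<Sum>k=1..n. \<omega> (q k) * (q k * e \<sigma> k)) = N + (s - \<sigma>) * A"
        unfolding N_def A_def sum_distrib_left sum.distrib[symmetric]
        by (intro sum.cong refl) (simp add: e_def power2_eq_square algebra_simps)
      with N[OF False] A0 show ?thesis by (simp add: abs_mult)
    qed
    also have "\<dots> \<le> (\<Sum>k=1..n. \<bar>\<omega> (q k) * (q k * e \<sigma> k)\<bar>)"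
      by (rule sum_abs)
    also have "\<dots> \<le> (\<Sum>k=1..n. max 2 B * \<bar>e \<sigma> k\<bar>)"
    proof (intro sum_mono)
      fix k
      have "\<bar>\<omega> (q k) * (q k * e \<sigma> k)\<bar> = (\<omega> (q k) * \<bar>q k\<bar>) * \<bar>e \<sigma> k\<bar>"
        using \<omega>0 by (simp add: abs_mult)
      also have "\<dots> \<le> max 2 B * \<bar>e \<sigma> k\<bar>"
        by (intro mult_right_mono qw) auto
      finally show "\<bar>\<omega> (q k) * (q k * e \<sigma> k)\<bar> \<le> max 2 B * \<bar>e \<sigma> k\<bar>" .
    qed
    finally show ?thesis
      unfolding A_def r2 e_def sum_distrib_left[symmetric] by simp
  qed
qed

section \<open>The mean distance between empirical and true distribution functions\<close>

text \<open>Bienayme's identity: independence factors the mixed expectations, and the centered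
  factors have mean 0. The uniform bound supplies all integrability.\<close>

lemma (in prob_space) expectation_sum_centered_square:
  fixes X :: "'i \<Rightarrow> 'a \<Rightarrow> real"
  assumes fin: "finite I" and indep: "indep_vars (\<lambda>_. borel) X I"
    and bnd: "\<And>i \<omega>. i \<in> I \<Longrightarrow> \<omega> \<in> space M \<Longrightarrow> \<bar>X i \<omega>\<bar> \<le> B"
    and mean: "\<And>i. i \<in> I \<Longrightarrow> expectation (X i) = m"
  shows "expectation (\<lambda>\<omega>. (\<Sum>i\<in>I. X i \<omega> - m)\<^sup>2) = (\<Sum>i\<in>I. expectation (\<lambda>\<omega>. (X i \<omega> - m)\<^sup>2))"
proof -
  define Y where "Y i \<omega> = X i \<omega> - m" for i \<omega>
  have X [measurable]: "X i \<in> borel_measurable M" if "i \<in> I" for i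
    using indep that by (auto simp: indep_vars_def)
  have Yb: "\<bar>Y i \<omega>\<bar> \<le> B + \<bar>m\<bar>" if "i \<in> I" "\<omega> \<in> space M" for i \<omega>
    using bnd[OF that] by (simp add: Y_def)
  have intX: "integrable M (X i)" if "i \<in> I" for i
    by (rule integrable_const_bound[of _ B]) (use bnd that in auto)
  have intY: "integrable M (Y i)" if "i \<in> I" for i
    using intX[OF that] unfolding Y_def by auto
  have EY: "expectation (Y i) = 0" if "i \<in> I" for i
    using intX[OF that] mean[OF that] unfolding Y_def by (simp add: prob_space)
  have intYY: "integrable M (\<lambda>\<omega>. Y i \<omega> * Y j \<omega>)" if "i \<in> I" "j \<in> I" for i j
  proof (rule integrable_const_bound[of _ "(B + \<bar>m\<bar>) * (B + \<bar>m\<bar>)"])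
    show "AE \<omega> in M. norm (Y i \<omega> * Y j \<omega>) \<le> (B + \<bar>m\<bar>) * (B + \<bar>m\<bar>)"
    proof (rule AE_I2)
      fix \<omega> assume w: "\<omega> \<in> space M"
      have "0 \<le> B + \<bar>m\<bar>" using Yb[OF that(1) w] by linarith
      then show "norm (Y i \<omega> * Y j \<omega>) \<le> (B + \<bar>m\<bar>) * (B + \<bar>m\<bar>)"
        unfolding real_norm_def abs_mult by (intro mult_mono Yb that w) auto
    qed
  qed (use intY that in \<open>auto intro!: borel_measurable_times simp: borel_measurable_integrable\<close>)
  have indepY: "indep_vars (\<lambda>_. borel) Y I"
    unfolding Y_def[abs_def] using indep by (rule indep_vars_compose2) auto
  have cross: "expectation (\<lambda>\<omega>. Y i \<omega> * Y j \<omega>) = 0" if "i \<in> I" "j \<in> I" "i \<noteq> j" for i j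
  proof -
    have "indep_vars (\<lambda>_. borel) Y {i, j}"
      using indepY by (rule indep_vars_subset) (use that in auto)
    from indep_vars_lebesgue_integral[OF _ this] show ?thesis
      using intY EY that by auto
  qed
  have "expectation (\<lambda>\<omega>. (\<Sum>i\<in>I. Y i \<omega>)\<^sup>2) = (\<Sum>i\<in>I. \<Sum>j\<in>I. expectation (\<lambda>\<omega>. Y i \<omega> * Y j \<omega>))"
    unfolding power2_eq_square sum_product
    by (subst Bochner_Integration.integral_sum)
      (auto intro!: intYY sum.cong Bochner_Integration.integral_sum)
  also have "\<dots> = (\<Sum>i\<in>I. \<Sum>j\<in>I. if j = i then expectation (\<lambda>\<omega>. (Y i \<omega>)\<^sup>2) else 0)"
    by (intro sum.cong refl) (auto simp: cross power2_eq_square)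
  also have "\<dots> = (\<Sum>i\<in>I. expectation (\<lambda>\<omega>. (Y i \<omega>)\<^sup>2))"
    using fin by simp
  finally show ?thesis by (simp add: Y_def)
qed

text \<open>This is the nonnegativity of the variance of \<open>\<bar>X\<bar>\<close>.\<close>

lemma (in prob_space) expectation_abs_le_sqrt:
  fixes X :: "'a \<Rightarrow> real"
  assumes [measurable]: "X \<in> borel_measurable M" and bnd: "\<And>\<omega>. \<omega> \<in> space M \<Longrightarrow> \<bar>X \<omega>\<bar> \<le> B"
  shows "expectation (\<lambda>\<omega>. \<bar>X \<omega>\<bar>) \<le> sqrt (expectation (\<lambda>\<omega>. (X \<omega>)\<^sup>2))"
proof -
  have 1: "integrable M (\<lambda>\<omega>. \<bar>X \<omega>\<bar>)"
    by (rule integrable_const_bound[of _ B]) (use bnd in auto)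
  have 2: "integrable M (\<lambda>\<omega>. \<bar>X \<omega>\<bar>\<^sup>2)"
  proof (rule integrable_const_bound[of _ "B\<^sup>2"])
    show "AE \<omega> in M. norm (\<bar>X \<omega>\<bar>\<^sup>2) \<le> B\<^sup>2"
      using bnd by (intro AE_I2) (metis abs_ge_zero norm_power power_mono real_norm_def abs_idempotent)
  qed auto
  have "(expectation (\<lambda>\<omega>. \<bar>X \<omega>\<bar>))\<^sup>2 \<le> expectation (\<lambda>\<omega>. \<bar>X \<omega>\<bar>\<^sup>2)"
    using variance_eq[OF 1 2] variance_positive[of "\<lambda>\<omega>. \<bar>X \<omega>\<bar>"] by simp
  then show ?thesis
    by (intro real_le_rsqrt) simp
qed

text \<open>The first absolute moment is bounded by the root of the second, which is the variance of
  a mean of independent terms. It is applied to indicators, for the empirical distribution function,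
  and to a bounded test function, for a law of large numbers.\<close>

lemma (in prob_space) expectation_abs_mean_deviation:
  fixes X :: "nat \<Rightarrow> 'a \<Rightarrow> real"
  assumes n: "1 \<le> n" and indep: "indep_vars (\<lambda>_. borel) X {1..n}"
    and bnd: "\<And>i \<omega>. i \<in> {1..n} \<Longrightarrow> \<omega> \<in> space M \<Longrightarrow> \<bar>X i \<omega>\<bar> \<le> B"
    and mean: "\<And>i. i \<in> {1..n} \<Longrightarrow> expectation (X i) = m"
    and var: "\<And>i. i \<in> {1..n} \<Longrightarrow> expectation (\<lambda>\<omega>. (X i \<omega> - m)\<^sup>2) \<le> V"
  shows "expectation (\<lambda>\<omega>. \<bar>(\<Sum>i=1..n. X i \<omega>) / real n - m\<bar>) \<le> sqrt (V / real n)"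
proof -
  have [measurable]: "X i \<in> borel_measurable M" if "i \<in> {1..n}" for i
    using indep that by (auto simp: indep_vars_def)
  have eq: "(\<Sum>i=1..n. X i \<omega>) / real n - m = (\<Sum>i=1..n. X i \<omega> - m) / real n" for \<omega>
    using n by (simp add: sum_subtractf field_simps)
  have "expectation (\<lambda>\<omega>. \<bar>(\<Sum>i=1..n. X i \<omega>) / real n - m\<bar>)
      \<le> sqrt (expectation (\<lambda>\<omega>. ((\<Sum>i=1..n. X i \<omega>) / real n - m)\<^sup>2))"
  proof (rule expectation_abs_le_sqrt)
    fix \<omega> assume w: "\<omega> \<in> space M"
    have "\<bar>(\<Sum>i=1..n. X i \<omega>)\<bar> \<le> (\<Sum>i=1..n. B)"
      by (rule order_trans[OF sum_abs sum_mono]) (use bnd w in auto)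
    then have "\<bar>(\<Sum>i=1..n. X i \<omega>) / real n\<bar> \<le> B"
      using n by (simp add: abs_divide divide_le_eq mult.commute)
    then show "\<bar>(\<Sum>i=1..n. X i \<omega>) / real n - m\<bar> \<le> B + \<bar>m\<bar>"
      by linarith
  qed auto
  also have "expectation (\<lambda>\<omega>. ((\<Sum>i=1..n. X i \<omega>) / real n - m)\<^sup>2)
      = (\<Sum>i=1..n. expectation (\<lambda>\<omega>. (X i \<omega> - m)\<^sup>2)) / (real n)\<^sup>2"
    unfolding eq power_divide
    using expectation_sum_centered_square[OF _ indep bnd mean] by simp
  also have "\<dots> \<le> (\<Sum>i=1..n. V) / (real n)\<^sup>2"
    by (intro divide_right_mono sum_mono var) auto
  also have "\<dots> = V / real n"
    using n by (simp add: power2_eq_square)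
  finally show ?thesis by simp
qed

text \<open>With \<open>F = cdf \<mu> x\<close>, the indicators of \<open>\<zeta> k\<close> \<le>
  \<open>x\<close> have variance \<open>F * (1 - F)\<close> and mean absolute deviation
  \<open>2 * F * (1 - F)\<close>, where \<open>F * (1 - F)\<close> \<le> \<open>v\<close>. The
  variance gives the square root, the deviation the linear term. Both are needed later: for
  \<open>v\<close> of order \<open>\<bar>x\<bar> powr - \<alpha>\<close> with 1 < \<alpha> < 2, the
  root is not integrable at infinity and the linear term is not integrable at 0.\<close>

lemma (in prob_space) nn_integral_ecdf_diff_le:
  assumes n: "1 \<le> n" and indep: "indep_vars (\<lambda>_. borel) \<zeta> {1..n}"
    and law: "\<And>k. k \<in> {1..n} \<Longrightarrow> distr M borel (\<zeta> k) = \<mu>"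
    and v: "cdf \<mu> x \<le> v \<or> 1 - cdf \<mu> x \<le> v"
  shows "(\<integral>\<^sup>+\<omega>. ennreal \<bar>ecdf n (\<lambda>k. \<zeta> k \<omega>) x - cdf \<mu> x\<bar> \<partial>M) \<le> ennreal (min (2 * v) (sqrt (v / real n)))"
proof -
  define F where "F = cdf \<mu> x"
  define X :: "nat \<Rightarrow> 'a \<Rightarrow> real" where "X k \<omega> = of_bool (\<zeta> k \<omega> \<le> x)" for k \<omega>
  have [measurable]: "\<zeta> k \<in> borel_measurable M" if "k \<in> {1..n}" for k
    using indep that by (auto simp: indep_vars_def)
  have Xm [measurable]: "X k \<in> borel_measurable M" if "k \<in> {1..n}" for k
    unfolding X_def[abs_def] using that by measurable
  have EX: "expectation (X k) = F" if "k \<in> {1..n}" for k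
  proof -
    have "expectation (X k) = expectation (indicator {\<omega> \<in> space M. \<zeta> k \<omega> \<le> x})"
      by (intro Bochner_Integration.integral_cong) (auto simp: X_def)
    also have "\<dots> = measure M {\<omega> \<in> space M. \<zeta> k \<omega> \<le> x}"
      using that by simp
    also have "\<dots> = F"
      using that unfolding F_def cdf_def law[OF that, symmetric]
      by (subst measure_distr) (auto intro!: arg_cong[where f="measure M"])
    finally show ?thesis .
  qed
  have intX: "integrable M (X k)" if "k \<in> {1..n}" for k
    using that by (intro integrable_const_bound[of _ 1]) (auto simp: X_def)
  have F01: "0 \<le> F" "F \<le> 1"
  proof -
    interpret \<mu>: prob_space \<mu>
      using n law[of 1] by (metis atLeastAtMost_iff \<open>\<And>k. k \<in> {1..n} \<Longrightarrow> \<zeta> k \<in> borel_measurable M\<close> order_refl prob_space_distr)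
    show "0 \<le> F" "F \<le> 1" unfolding F_def cdf_def by auto
  qed
  have Fv: "F * (1 - F) \<le> v"
    using v F01 mult_left_le[of "1 - F" F] mult_left_le[of F "1 - F"]
    by (auto simp: F_def[symmetric] mult.commute)
  have indepX: "indep_vars (\<lambda>_. borel) X {1..n}"
    unfolding X_def[abs_def] using indep by (rule indep_vars_compose2) auto
  have e: "ecdf n (\<lambda>k. \<zeta> k \<omega>) x = (\<Sum>k=1..n. X k \<omega>) / real n" for \<omega>
    by (simp add: ecdf_def X_def)
  have Xb: "\<bar>X k \<omega>\<bar> \<le> 1" for k \<omega> by (simp add: X_def)
  have "expectation (\<lambda>\<omega>. \<bar>(\<Sum>k=1..n. X k \<omega>) / real n - F\<bar>) \<le> sqrt (F * (1 - F) / real n)"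
  proof (rule expectation_abs_mean_deviation[OF n indepX Xb EX])
    fix k assume k: "k \<in> {1..n}"
    \<comment> \<open>An indicator equals its square, so the square is affine in
      \<open>X k\<close>.\<close>
    have "(X k \<omega> - F)\<^sup>2 = (1 - 2 * F) * X k \<omega> + F\<^sup>2" for \<omega>
      by (auto simp: X_def power2_eq_square algebra_simps)
    then have "expectation (\<lambda>\<omega>. (X k \<omega> - F)\<^sup>2) = (1 - 2 * F) * F + F\<^sup>2"
      using intX[OF k] EX[OF k] by (simp add: prob_space)
    then show "expectation (\<lambda>\<omega>. (X k \<omega> - F)\<^sup>2) \<le> F * (1 - F)"
      by (simp add: power2_eq_square algebra_simps)
  qed
  also have "\<dots> \<le> sqrt (v / real n)"
    by (intro real_sqrt_le_mono divide_right_mono Fv) auto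
  finally have 1: "expectation (\<lambda>\<omega>. \<bar>(\<Sum>k=1..n. X k \<omega>) / real n - F\<bar>) \<le> sqrt (v / real n)" .
  \<comment> \<open>This is \<open>\<bar>X k \<omega> - F\<bar>\<close>, written as an affine
    function of the indicator so that its mean can be read off.\<close>
  define G where "G k \<omega> = (1 - F) * X k \<omega> + F * (1 - X k \<omega>)" for k \<omega>
  have intG: "integrable M (G k)" if "k \<in> {1..n}" for k
    unfolding G_def[abs_def] using intX[OF that] by auto
  have EG: "expectation (G k) = 2 * (F * (1 - F))" if "k \<in> {1..n}" for k
    unfolding G_def[abs_def] using intX[OF that] EX[OF that] by (simp add: prob_space algebra_simps)
  have "expectation (\<lambda>\<omega>. \<bar>(\<Sum>k=1..n. X k \<omega>) / real n - F\<bar>)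
      \<le> expectation (\<lambda>\<omega>. (\<Sum>k=1..n. G k \<omega>) / real n)"
  proof (rule integral_mono)
    show "integrable M (\<lambda>\<omega>. \<bar>(\<Sum>k=1..n. X k \<omega>) / real n - F\<bar>)"
      by (intro integrable_abs Bochner_Integration.integrable_diff
          Bochner_Integration.integrable_divide_zero Bochner_Integration.integrable_sum intX) auto
    show "integrable M (\<lambda>\<omega>. (\<Sum>k=1..n. G k \<omega>) / real n)"
      by (intro Bochner_Integration.integrable_divide_zero Bochner_Integration.integrable_sum intG)
    fix \<omega>
    have "\<bar>(\<Sum>k=1..n. X k \<omega>) / real n - F\<bar> = \<bar>\<Sum>k=1..n. X k \<omega> - F\<bar> / real n"
    proof -
      have "(\<Sum>k=1..n. X k \<omega>) / real n - F = (\<Sum>k=1..n. X k \<omega> - F) / real n"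
        using n by (simp add: sum_subtractf diff_divide_distrib)
      then show ?thesis by (simp only: abs_divide abs_of_nat)
    qed
    also have "\<dots> \<le> (\<Sum>k=1..n. G k \<omega>) / real n"
      using F01
      by (intro divide_right_mono order_trans[OF sum_abs sum_mono]) (auto simp: X_def G_def)
    finally show "\<bar>(\<Sum>k=1..n. X k \<omega>) / real n - F\<bar> \<le> (\<Sum>k=1..n. G k \<omega>) / real n" .
  qed
  also have "\<dots> = (\<Sum>k=1..n. expectation (G k)) / real n"
    by (subst Bochner_Integration.integral_divide_zero, subst Bochner_Integration.integral_sum) (auto intro: intG)
  also have "\<dots> = (\<Sum>k=1..n. 2 * (F * (1 - F))) / real n"
    by (intro arg_cong2[where f="(/)"] sum.cong refl EG)
  also have "\<dots> = 2 * (F * (1 - F))"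
    using n by simp
  also have "\<dots> \<le> 2 * v"
    using Fv by simp
  finally have 2: "expectation (\<lambda>\<omega>. \<bar>(\<Sum>k=1..n. X k \<omega>) / real n - F\<bar>) \<le> 2 * v" .
  have "(\<integral>\<^sup>+\<omega>. ennreal \<bar>ecdf n (\<lambda>k. \<zeta> k \<omega>) x - cdf \<mu> x\<bar> \<partial>M)
      = ennreal (expectation (\<lambda>\<omega>. \<bar>(\<Sum>k=1..n. X k \<omega>) / real n - F\<bar>))"
    unfolding e F_def[symmetric]
    by (intro nn_integral_eq_integral integrable_abs Bochner_Integration.integrable_diff
        Bochner_Integration.integrable_divide_zero Bochner_Integration.integrable_sum intX) auto
  with 1 2 show ?thesis by (auto intro: ennreal_leI)
qed

lemma nn_integral_symmetric_halfline:
  fixes f :: "real \<Rightarrow> ennreal"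
  assumes [measurable]: "f \<in> borel_measurable borel"
    and sym: "\<And>x. f (- x) = f x"
  shows "(\<integral>\<^sup>+x. f x \<partial>lborel) = 2 * (\<integral>\<^sup>+x. f x * indicator {0..} x \<partial>lborel)"
proof -
  have "(\<integral>\<^sup>+x. f x \<partial>lborel) = (\<integral>\<^sup>+x. f x * indicator {0..} x + f x * indicator {..0} x \<partial>lborel)"
    by (intro nn_integral_cong_AE) (use AE_lborel_singleton[of 0] in \<open>auto simp: indicator_def\<close>)
  also have "\<dots> = (\<integral>\<^sup>+x. f x * indicator {0..} x \<partial>lborel) + (\<integral>\<^sup>+x. f x * indicator {..0} x \<partial>lborel)"
    by (rule nn_integral_add) auto
  also have "(\<integral>\<^sup>+x. f x * indicator {..0} x \<partial>lborel) = (\<integral>\<^sup>+x. f x * indicator {0..} x \<partial>lborel)"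
    by (subst nn_integral_real_affine[of _ "- 1" 0])
      (auto simp: sym indicator_def intro!: nn_integral_cong)
  finally show ?thesis by (simp add: mult_2)
qed

section \<open>Integrating the pointwise bound over the line\<close>

text \<open>The bound of \<open>nn_integral_ecdf_diff_le\<close> with a stable tail in place of
  \<open>v\<close> and \<open>m\<close> in place of the sample size. As \<open>0 powr y = 0\<close>,
  its value at 0 is 0, so it can serve as a bound only off the origin.\<close>

definition tail_bound :: "real \<Rightarrow> real \<Rightarrow> real \<Rightarrow> real \<Rightarrow> real" where
  "tail_bound C \<alpha> m x = min (2 * (C * \<bar>x\<bar> powr - \<alpha>)) (sqrt (C * \<bar>x\<bar> powr - \<alpha> / m))"

lemma tail_bound_measurable [measurable]: "tail_bound C \<alpha> m \<in> borel_measurable borel"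
  unfolding tail_bound_def[abs_def] by measurable

text \<open>The root branch is integrable near 0 because \<alpha> < 2, the linear branch at infinity
  because \<alpha> > 1.\<close>

lemma nn_integral_tail_bound_finite:
  assumes "1 < \<alpha>" "\<alpha> < 2" "0 \<le> C"
  shows "(\<integral>\<^sup>+x. ennreal (tail_bound C \<alpha> 1 x) \<partial>lborel) < \<infinity>"
proof -
  have a: "sqrt (C * x powr - \<alpha>) = sqrt C * x powr (- \<alpha> / 2)" for x
    by (simp add: real_sqrt_mult powr_half_sqrt[symmetric] powr_powr)
  have "(\<integral>\<^sup>+x. ennreal (tail_bound C \<alpha> 1 x) * indicator {0..} x \<partial>lborel)
    \<le> (\<integral>\<^sup>+x. ennreal (sqrt C * x powr (- \<alpha> / 2)) * indicator {0..1} x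
        + ennreal (2 * C * x powr - \<alpha>) * indicator {1..} x \<partial>lborel)"
    using \<open>0 \<le> C\<close>
    by (intro nn_integral_mono) (auto simp: indicator_def tail_bound_def a simp flip: ennreal_plus intro!: ennreal_leI)
  also have "\<dots> = (\<integral>\<^sup>+x. ennreal (sqrt C * x powr (- \<alpha> / 2)) * indicator {0..1} x \<partial>lborel)
      + (\<integral>\<^sup>+x. ennreal (2 * C * x powr - \<alpha>) * indicator {1..} x \<partial>lborel)"
    by (rule nn_integral_add) auto
  also have "(\<integral>\<^sup>+x. ennreal (sqrt C * x powr (- \<alpha> / 2)) * indicator {0..1} x \<partial>lborel)
      = ennreal (sqrt C * (1 powr (- \<alpha> / 2 + 1) / (- \<alpha> / 2 + 1)))"
    using assms
    by (intro nn_integral_has_integral_lebesgue' has_integral_mult_right has_integral_powr_from_0) auto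
  also have "(\<integral>\<^sup>+x. ennreal (2 * C * x powr - \<alpha>) * indicator {1..} x \<partial>lborel)
      = ennreal (2 * C * (- (1 powr (- \<alpha> + 1)) / (- \<alpha> + 1)))"
    using assms
    by (intro nn_integral_has_integral_lebesgue' has_integral_mult_right has_integral_powr_to_inf) auto
  finally have "(\<integral>\<^sup>+x. ennreal (tail_bound C \<alpha> 1 x) * indicator {0..} x \<partial>lborel) < \<infinity>"
    by (rule le_less_trans) (simp add: ennreal_add_less_top)
  moreover have "tail_bound C \<alpha> 1 (- x) = tail_bound C \<alpha> 1 x" for x
    by (simp add: tail_bound_def)
  ultimately show ?thesis
    by (subst nn_integral_symmetric_halfline) (auto simp: ennreal_mult_less_top)
qed

text \<open>The substitution \<open>x = m powr (1 / \<alpha>) * y\<close> turns both branches of the minimum into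
  \<open>1 / m\<close> times their value for \<open>m = 1\<close>.\<close>

lemma nn_integral_tail_bound:
  assumes "0 < \<alpha>" "0 < m"
  shows "(\<integral>\<^sup>+x. ennreal (tail_bound C \<alpha> m x) \<partial>lborel)
    = ennreal (m powr (1 / \<alpha> - 1)) * (\<integral>\<^sup>+x. ennreal (tail_bound C \<alpha> 1 x) \<partial>lborel)"
proof -
  define c where "c = m powr (1 / \<alpha>)"
  have c: "c > 0" using assms by (simp add: c_def)
  have "tail_bound C \<alpha> m (c * x) = tail_bound C \<alpha> 1 x / m" for x
  proof -
    have "\<bar>c * x\<bar> powr - \<alpha> = \<bar>x\<bar> powr - \<alpha> / m"
      using assms by (simp add: c_def abs_mult powr_mult powr_powr powr_minus field_simps)
    then have "tail_bound C \<alpha> m (c * x) = min (2 * (C * \<bar>x\<bar> powr - \<alpha>) / m) (sqrt (C * \<bar>x\<bar> powr - \<alpha> / m\<^sup>2))"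
      unfolding tail_bound_def by (simp add: power2_eq_square)
    also have "\<dots> = tail_bound C \<alpha> 1 x / m"
      using assms unfolding tail_bound_def real_sqrt_divide by (simp add: min_divide_distrib_right)
    finally show ?thesis .
  qed
  then have "(\<integral>\<^sup>+x. ennreal (tail_bound C \<alpha> m x) \<partial>lborel)
      = ennreal c * (\<integral>\<^sup>+x. ennreal (1 / m) * ennreal (tail_bound C \<alpha> 1 x) \<partial>lborel)"
    using c assms by (subst nn_integral_real_affine[of _ c 0]) (simp_all flip: ennreal_mult')
  also have "\<dots> = ennreal (c * (1 / m)) * (\<integral>\<^sup>+x. ennreal (tail_bound C \<alpha> 1 x) \<partial>lborel)"
    using c assms by (subst nn_integral_cmult) (measurable, simp only: ennreal_mult' less_imp_le mult.assoc)
  also have "c * (1 / m) = m powr (1 / \<alpha> - 1)"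
    using assms by (simp add: c_def powr_diff)
  finally show ?thesis .
qed

text \<open>Tonelli's theorem exchanges the expectation with the integral in \<open>x\<close>, after
  which the pointwise bound applies for every \<open>x\<close> except the null set {0}.\<close>

lemma (in prob_space) nn_integral_cdf_dist_ecdf:
  assumes n: "1 \<le> n" and indep: "indep_vars (\<lambda>_. borel) \<zeta> {1..n}"
    and law: "\<And>k. k \<in> {1..n} \<Longrightarrow> distr M borel (\<zeta> k) = \<mu>"
    and [measurable]: "cdf \<mu> \<in> borel_measurable borel"
    and tail: "\<And>x. x \<noteq> 0 \<Longrightarrow> cdf \<mu> x \<le> C * \<bar>x\<bar> powr - \<alpha> \<or> 1 - cdf \<mu> x \<le> C * \<bar>x\<bar> powr - \<alpha>"
  shows "(\<lambda>\<omega>. cdf_dist (ecdf n (\<lambda>k. \<zeta> k \<omega>)) (cdf \<mu>)) \<in> borel_measurable M"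
    and "(\<integral>\<^sup>+\<omega>. cdf_dist (ecdf n (\<lambda>k. \<zeta> k \<omega>)) (cdf \<mu>) \<partial>M) \<le> (\<integral>\<^sup>+x. ennreal (tail_bound C \<alpha> (real n) x) \<partial>lborel)"
proof -
  interpret pair_sigma_finite M lborel
    by unfold_locales
  have [measurable]: "\<zeta> k \<in> borel_measurable M" if "k \<in> {1..n}" for k
    using indep that by (auto simp: indep_vars_def)
  have m [measurable]: "(\<lambda>(\<omega>, x). ennreal \<bar>ecdf n (\<lambda>k. \<zeta> k \<omega>) x - cdf \<mu> x\<bar>) \<in> borel_measurable (M \<Otimes>\<^sub>M lborel)"
    unfolding ecdf_def by measurable
  show "(\<lambda>\<omega>. cdf_dist (ecdf n (\<lambda>k. \<zeta> k \<omega>)) (cdf \<mu>)) \<in> borel_measurable M"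
    unfolding cdf_dist_def by measurable
  have "(\<integral>\<^sup>+\<omega>. cdf_dist (ecdf n (\<lambda>k. \<zeta> k \<omega>)) (cdf \<mu>) \<partial>M)
      = (\<integral>\<^sup>+x. \<integral>\<^sup>+\<omega>. ennreal \<bar>ecdf n (\<lambda>k. \<zeta> k \<omega>) x - cdf \<mu> x\<bar> \<partial>M \<partial>lborel)"
    unfolding cdf_dist_def by (rule Fubini'[OF m, symmetric])
  also have "\<dots> \<le> (\<integral>\<^sup>+x. ennreal (tail_bound C \<alpha> (real n) x) \<partial>lborel)"
    unfolding tail_bound_def
  proof (rule nn_integral_mono_AE)
    show "AE x in lborel. (\<integral>\<^sup>+\<omega>. ennreal \<bar>ecdf n (\<lambda>k. \<zeta> k \<omega>) x - cdf \<mu> x\<bar> \<partial>M)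
        \<le> ennreal (min (2 * (C * \<bar>x\<bar> powr - \<alpha>)) (sqrt (C * \<bar>x\<bar> powr - \<alpha> / real n)))"
      using AE_lborel_singleton[of 0]
      by eventually_elim (rule nn_integral_ecdf_diff_le[OF n indep law tail])
  qed
  finally show "(\<integral>\<^sup>+\<omega>. cdf_dist (ecdf n (\<lambda>k. \<zeta> k \<omega>)) (cdf \<mu>) \<partial>M)
      \<le> (\<integral>\<^sup>+x. ennreal (tail_bound C \<alpha> (real n) x) \<partial>lborel)" .
qed

section \<open>Quantiles at equally spaced levels\<close>

text \<open>The Galois connection between a distribution function and its quantile. For
  \<open>u\<close> strictly between 0 and 1, the limits 1 and 0 at the two ends make the set
  \<open>S\<close> nonempty and bounded below, and right-continuity puts its infimum into
  \<open>S\<close>.\<close>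

lemma quantile_le_iff:
  assumes "real_distribution \<mu>" and u: "0 < u" "u < 1"
  shows "quantile (cdf \<mu>) u \<le> x \<longleftrightarrow> u \<le> cdf \<mu> x"
proof -
  interpret real_distribution \<mu> by fact
  define S where "S = {x. u \<le> cdf \<mu> x}"
  have "eventually (\<lambda>x. u < cdf \<mu> x) at_top"
    using cdf_lim_at_top_prob u by (auto simp: order_tendsto_iff)
  then have ne: "S \<noteq> {}"
    unfolding S_def by (auto simp: eventually_at_top_linorder intro: less_imp_le)
  have "eventually (\<lambda>x. cdf \<mu> x < u) at_bot"
    using cdf_lim_at_bot u by (auto simp: order_tendsto_iff)
  then obtain b where b: "\<And>x. x \<le> b \<Longrightarrow> cdf \<mu> x < u"
    by (auto simp: eventually_at_bot_linorder)
  have bdd: "bdd_below S"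
    by (rule bdd_belowI[of _ b]) (metis S_def b linorder_not_less mem_Collect_eq nle_le)
  have "Inf S \<in> S"
  proof (rule ccontr)
    assume "Inf S \<notin> S"
    then have "cdf \<mu> (Inf S) < u" by (simp add: S_def)
    then have "eventually (\<lambda>x. cdf \<mu> x < u) (at_right (Inf S))"
      using cdf_is_right_cont[of "Inf S"] unfolding continuous_within by (auto simp: order_tendsto_iff)
    then obtain c where c: "c > Inf S" "\<And>x. Inf S < x \<Longrightarrow> x < c \<Longrightarrow> cdf \<mu> x < u"
      by (auto simp: eventually_at_right_field)
    then obtain y where y: "y \<in> S" "y < c"
      using cInf_lessD[OF ne] by blast
    moreover have "Inf S \<le> y" using cInf_lower[OF y(1) bdd] .
    ultimately show False
      using c(2)[of y] \<open>Inf S \<notin> S\<close> by (cases "y = Inf S") (auto simp: S_def)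
  qed
  then show ?thesis
    using cInf_lower[OF _ bdd] cdf_nondecreasing[of "Inf S" x]
    unfolding quantile_def S_def[symmetric] by (auto simp: S_def)
qed

text \<open>The deterministic proxy obeys the same pointwise bound as the mean over a random sample.
  By the Galois connection, the number of quantiles up to \<open>x\<close> is the integer part of
  \<open>(n + 1) * F\<close>, capped at \<open>n\<close>, so the error is at most
  \<open>F / n\<close> upwards and \<open>(1 - F) / n\<close> downwards. It is thus at most
  \<open>v\<close> and at most \<open>1 / n\<close>, hence at most the geometric mean of the
  two.\<close>

lemma ecdf_quantile_diff_le:
  assumes "real_distribution \<mu>" and n: "1 \<le> n"
    and v: "cdf \<mu> x \<le> v \<or> 1 - cdf \<mu> x \<le> v"
  shows "\<bar>ecdf n (\<lambda>k. quantile (cdf \<mu>) (real k / (real n + 1))) x - cdf \<mu> x\<bar> \<le> min (2 * v) (sqrt (v / real n))"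
proof -
  interpret real_distribution \<mu> by fact
  define F where "F = cdf \<mu> x"
  define e where "e = ecdf n (\<lambda>k. quantile (cdf \<mu>) (real k / (real n + 1))) x"
  have F: "0 \<le> F" "F \<le> 1" by (auto simp: F_def cdf_nonneg cdf_bounded_prob)
  have e01: "0 \<le> e" "e \<le> 1" by (simp_all add: e_def ecdf_nonneg ecdf_le_1)
  define N where "N = nat \<lfloor>(real n + 1) * F\<rfloor>"
  have N: "real N \<le> (real n + 1) * F" "(real n + 1) * F < real N + 1"
    using F unfolding N_def by (simp_all add: le_nat_iff nat_less_iff)
  have "e = (\<Sum>k=1..n. of_bool (k \<le> N)) / real n"
    unfolding e_def ecdf_def
  proof (intro arg_cong2[where f="(/)"] sum.cong refl arg_cong[where f=of_bool])
    fix k assume k: "k \<in> {1..n}"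
    have "quantile (cdf \<mu>) (real k / (real n + 1)) \<le> x \<longleftrightarrow> real k \<le> (real n + 1) * F"
      using k assms(1) by (subst quantile_le_iff) (auto simp: F_def divide_le_eq mult.commute)
    also have "\<dots> \<longleftrightarrow> k \<le> N"
      using N by linarith
    finally show "quantile (cdf \<mu>) (real k / (real n + 1)) \<le> x \<longleftrightarrow> k \<le> N" .
  qed
  also have "(\<Sum>k=1..n. of_bool (k \<le> N)) = real (min n N)"
  proof -
    have "{1..n} \<inter> {k. k \<le> N} = {1..min n N}" by auto
    then show ?thesis by simp
  qed
  finally have e: "e = real (min n N) / real n" .
  have F1: "(real n + 1) * F / real n = F + F / real n"
    using n by (simp add: distrib_right add_divide_distrib)
  have "e \<le> real N / real n"
    unfolding e by (intro divide_right_mono) auto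
  also have "\<dots> \<le> (real n + 1) * F / real n"
    by (intro divide_right_mono N) auto
  finally have up: "e - F \<le> F / real n"
    unfolding F1 by simp
  have low: "F - e \<le> (1 - F) / real n"
  proof (cases "N \<le> n")
    case True
    have "(real n + 1) * F / real n \<le> (real N + 1) / real n"
      using N(2) by (intro divide_right_mono) auto
    then have "F + F / real n \<le> e + 1 / real n"
      unfolding F1 using True by (simp add: e add_divide_distrib)
    then show ?thesis by (simp add: diff_divide_distrib)
  next
    \<comment> \<open>This occurs only for \<open>F = 1\<close>, where the integer part is
      \<open>n + 1\<close> and the cap is active.\<close>
    case False
    then have "e = 1" using n by (simp add: e)
    moreover have "0 \<le> (1 - F) / real n" using F by simp
    ultimately show ?thesis using F by linarith
  qed
  have Fn: "F / real n \<le> F" "(1 - F) / real n \<le> 1 - F" "F / real n \<le> 1 / real n" "(1 - F) / real n \<le> 1 / real n"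
    using F n mult_left_mono[of 1 "real n" F] mult_left_mono[of 1 "real n" "1 - F"]
    by (simp_all add: divide_le_eq divide_right_mono)
  have d: "\<bar>e - F\<bar> \<le> v" "\<bar>e - F\<bar> \<le> 1 / real n"
    using v up low e01 Fn unfolding F_def[symmetric] by linarith+
  then have v0: "0 \<le> v" by linarith
  have "\<bar>e - F\<bar>\<^sup>2 \<le> v * (1 / real n)"
    unfolding power2_eq_square by (intro mult_mono d v0) auto
  then have "\<bar>e - F\<bar> \<le> sqrt (v / real n)"
    by (intro real_le_rsqrt) auto
  with d v0 show ?thesis unfolding e_def F_def by auto
qed

section \<open>Tails of stable laws\<close>

text \<open>The truncation inequality. Integrating \<open>1 - cos (t * x)\<close> over
  \<open>t\<close> in [-u, u] gives \<open>2 * u - 2 * sin (u * x) / x\<close>, which is at least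
  \<open>u\<close> once \<open>\<bar>x\<bar>\<close> \<ge> \<open>2 / u\<close>; Tonelli's theorem
  turns the mean of this integral into an integral of \<open>1 - Re (char M t)\<close>.\<close>

lemma (in real_distribution) tail_le_char:
  assumes u: "0 < u" and e: "\<And>t. \<bar>t\<bar> \<le> u \<Longrightarrow> 1 - Re (char M t) \<le> e"
  shows "prob {x. 2 / u \<le> \<bar>x\<bar>} \<le> 2 * e"
proof -
  interpret pair_sigma_finite M lborel by unfold_locales
  define g where "g x t = ennreal (1 - cos (t * x)) * indicator {- u..u} t" for x t :: real
  have g_meas [measurable]: "(\<lambda>(x, t). g x t) \<in> borel_measurable (M \<Otimes>\<^sub>M lborel)"
    unfolding g_def by measurable
  have "0 \<le> 1 - Re (char M 0)" by (simp add: char_zero)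
  then have e0: "0 \<le> e" using e[of 0] u by simp
  have inner: "ennreal u \<le> (\<integral>\<^sup>+t. g x t \<partial>lborel)" if x: "2 / u \<le> \<bar>x\<bar>" for x
  proof -
    have x0: "x \<noteq> 0" using x u by (auto simp: divide_le_0_iff)
    have "((\<lambda>t. 1 - cos (t * x)) has_integral (u - sin (u * x) / x) - (- u - sin (- u * x) / x)) {- u..u}"
      using u x0
      by (intro fundamental_theorem_of_calculus)
        (auto intro!: derivative_eq_intros simp flip: has_real_derivative_iff_has_vector_derivative)
    then have "(\<integral>\<^sup>+t. g x t \<partial>lborel) = ennreal ((u - sin (u * x) / x) - (- u - sin (- u * x) / x))"
      unfolding g_def by (intro nn_integral_has_integral_lebesgue') auto
    also have "(u - sin (u * x) / x) - (- u - sin (- u * x) / x) = 2 * u - 2 * (sin (u * x) / x)"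
      by simp
    finally have eq: "(\<integral>\<^sup>+t. g x t \<partial>lborel) = ennreal (2 * u - 2 * (sin (u * x) / x))" .
    have "sin (u * x) / x \<le> \<bar>sin (u * x)\<bar> / \<bar>x\<bar>"
      by (metis abs_divide abs_ge_self)
    also have "\<dots> \<le> 1 / \<bar>x\<bar>" by (intro divide_right_mono) auto
    also have "\<dots> \<le> u / 2" using x x0 u by (simp add: field_simps)
    finally show ?thesis unfolding eq by (intro ennreal_leI) linarith
  qed
  have "ennreal (u * prob {x. 2 / u \<le> \<bar>x\<bar>}) = (\<integral>\<^sup>+x. ennreal u * indicator {x. 2 / u \<le> \<bar>x\<bar>} x \<partial>M)"
    using u by (subst nn_integral_cmult_indicator) (auto simp: emeasure_eq_measure ennreal_mult)
  also have "\<dots> \<le> (\<integral>\<^sup>+x. \<integral>\<^sup>+t. g x t \<partial>lborel \<partial>M)"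
    by (intro nn_integral_mono) (auto simp: indicator_def inner)
  also have "\<dots> = (\<integral>\<^sup>+t. \<integral>\<^sup>+x. g x t \<partial>M \<partial>lborel)"
    by (rule Fubini'[OF g_meas, symmetric])
  also have "\<dots> \<le> (\<integral>\<^sup>+t. ennreal e * indicator {- u..u} t \<partial>lborel)"
  proof (intro nn_integral_mono)
    fix t :: real
    have int: "integrable M (\<lambda>x. cos (t * x))"
      by (rule integrable_const_bound[of _ 1]) auto
    have "Re (char M t) = (\<integral>x. Re (iexp (t * x)) \<partial>M)"
      unfolding char_def by (rule integral_Re[symmetric]) (rule integrable_iexp, auto)
    then have "Re (char M t) = expectation (\<lambda>x. cos (t * x))"
      by (simp add: Re_exp)
    then have "(\<integral>\<^sup>+x. ennreal (1 - cos (t * x)) \<partial>M) = ennreal (1 - Re (char M t))"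
      using int by (subst nn_integral_eq_integral) (auto simp: prob_space[unfolded space_eq_univ])
    then show "(\<integral>\<^sup>+x. g x t \<partial>M) \<le> ennreal e * indicator {- u..u} t"
      using e[of t] by (auto simp: g_def indicator_def intro!: ennreal_leI)
  qed
  also have "\<dots> = ennreal (u * (2 * e))"
    using u e0 by (subst nn_integral_cmult_indicator) (auto simp flip: ennreal_mult)
  finally have "u * prob {x. 2 / u \<le> \<bar>x\<bar>} \<le> u * (2 * e)"
    using u e0 by (subst (asm) ennreal_le_iff) auto
  then show ?thesis using u by simp
qed

lemma char_distr_affine:
  assumes "real_distribution \<mu>"
  shows "char (distr \<mu> borel (\<lambda>u. c * u + d)) t = iexp (t * d) * char \<mu> (c * t)"
proof -
  interpret real_distribution \<mu> by fact
  have "char (distr \<mu> borel (\<lambda>u. c * u + d)) t = (CLINT u|\<mu>. iexp (t * d) * iexp (c * t * u))"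
    unfolding char_def
    by (subst integral_distr) (auto simp: exp_add[symmetric] algebra_simps intro!: Bochner_Integration.integral_cong)
  also have "\<dots> = iexp (t * d) * char \<mu> (c * t)"
    by (simp add: char_def)
  finally show ?thesis .
qed

lemma char_distr_pair_linear:
  assumes "real_distribution \<mu>"
  shows "char (distr (\<mu> \<Otimes>\<^sub>M \<mu>) borel (\<lambda>(u, v). a * u + b * v)) t = char \<mu> (a * t) * char \<mu> (b * t)"
proof -
  interpret real_distribution \<mu> by fact
  interpret P: pair_prob_space \<mu> \<mu> by unfold_locales
  have s [simp, measurable_cong]: "sets \<mu> = sets borel" by simp
  have int: "complex_integrable (\<mu> \<Otimes>\<^sub>M \<mu>) (\<lambda>(u, v). iexp (a * t * u) * iexp (b * t * v))"
    by (rule P.P.integrable_const_bound[of _ 1]) (auto simp: norm_mult split: prod.split)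
  have "char (distr (\<mu> \<Otimes>\<^sub>M \<mu>) borel (\<lambda>(u, v). a * u + b * v)) t
      = (CLINT (u, v)|(\<mu> \<Otimes>\<^sub>M \<mu>). iexp (a * t * u) * iexp (b * t * v))"
    unfolding char_def
    by (subst integral_distr) (auto simp: exp_add[symmetric] algebra_simps split_beta intro!: Bochner_Integration.integral_cong)
  also have "\<dots> = (CLINT u|\<mu>. CLINT v|\<mu>. iexp (a * t * u) * iexp (b * t * v))"
    using P.integral_fst'[OF int] by simp
  also have "\<dots> = char \<mu> (a * t) * char \<mu> (b * t)"
    by (simp add: char_def)
  finally show ?thesis .
qed

text \<open>The relation \<open>\<theta> (c * t) = (\<theta> t)\<^sup>2\<close> is iterated as long as \<open>c ^ k * t\<close> stays in the range
  where \<open>\<theta> \<ge> 1/2\<close>; Bernoulli's inequality for \<open>(\<theta> t) ^ (2 ^ k) \<ge> 1/2\<close> then bounds \<open>1 - \<theta> t\<close>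
  by \<open>2 powr - k\<close>.\<close>

lemma one_minus_le_powr:
  fixes \<theta> :: "real \<Rightarrow> real"
  assumes \<alpha>: "0 < \<alpha>" and c: "c = 2 powr (1 / \<alpha>)"
    and \<theta>: "\<And>t. 0 \<le> \<theta> t" "\<And>t. \<theta> t \<le> 1" "\<And>t. \<theta> (c * t) = (\<theta> t)\<^sup>2"
    and t0: "0 < t0" "\<And>t. \<bar>t\<bar> \<le> t0 \<Longrightarrow> 1 / 2 \<le> \<theta> t"
  shows "1 - \<theta> t \<le> 2 * t0 powr - \<alpha> * \<bar>t\<bar> powr \<alpha>"
proof -
  have c1: "1 < c" unfolding c using powr_less_mono[of 0 "1 / \<alpha>" 2] \<alpha> by simp
  consider "t = 0" | "t0 < \<bar>t\<bar>" | "t \<noteq> 0" "\<bar>t\<bar> \<le> t0" by linarith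
  then show ?thesis
  proof cases
    case 1
    have "\<theta> 0 = (\<theta> 0)\<^sup>2" using \<theta>(3)[of 0] by simp
    moreover have "\<theta> 0 \<noteq> 0" using t0(2)[of 0] t0(1) by auto
    ultimately show ?thesis using 1 by (simp add: power2_eq_square)
  next
    case 2
    have "t0 powr \<alpha> \<le> \<bar>t\<bar> powr \<alpha>"
      using 2 \<alpha> t0(1) by (intro powr_mono2) auto
    then have "1 \<le> t0 powr - \<alpha> * \<bar>t\<bar> powr \<alpha>"
      using t0(1) by (simp add: powr_minus field_simps)
    then show ?thesis using \<theta>(1)[of t] by linarith
  next
    case 3
    have "\<exists>k. t0 / \<bar>t\<bar> < c ^ k"
      by (rule real_arch_pow[OF c1])
    \<comment> \<open>The first power that carries \<open>\<bar>t\<bar>\<close> beyond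
      \<open>t0\<close>. Its predecessor \<open>k\<close> is the last one that stays in the range
      where \<theta> \<ge> 1/2.\<close>
    define m where "m = (LEAST k. t0 / \<bar>t\<bar> < c ^ k)"
    have m: "t0 / \<bar>t\<bar> < c ^ m"
      unfolding m_def by (rule LeastI_ex) fact
    have "m \<noteq> 0"
      using m 3 by (intro notI) (simp add: divide_less_eq)
    then obtain k where k: "m = Suc k" by (cases m) auto
    have "\<not> t0 / \<bar>t\<bar> < c ^ k"
      using not_less_Least[of k "\<lambda>k. t0 / \<bar>t\<bar> < c ^ k"] k unfolding m_def by auto
    then have le: "\<bar>c ^ k * t\<bar> \<le> t0"
      using 3 c1 by (simp add: field_simps abs_mult)
    have pow: "\<theta> (c ^ j * t) = \<theta> t ^ (2 ^ j)" for j
    proof (induction j)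
      case (Suc j)
      have "\<theta> (c ^ Suc j * t) = (\<theta> (c ^ j * t))\<^sup>2"
        using \<theta>(3)[of "c ^ j * t"] by (simp add: mult.assoc)
      also have "\<dots> = \<theta> t ^ (2 ^ Suc j)"
        unfolding Suc by (simp add: power_mult[symmetric] mult.commute)
      finally show ?case .
    qed simp
    define y where "y = \<theta> t"
    have "1 / 2 \<le> y ^ (2 ^ k)"
      using t0(2)[OF le] pow[of k] by (simp add: y_def)
    then have y0: "0 < y"
    proof -
      have "y \<noteq> 0"
      proof
        assume "y = 0"
        then have "y ^ (2 ^ k) = 0" by (simp only: zero_power zero_less_power zero_less_numeral)
        with \<open>1 / 2 \<le> y ^ (2 ^ k)\<close> show False by linarith
      qed
      with \<theta>(1)[of t] show ?thesis unfolding y_def by linarith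
    qed
    \<comment> \<open>Bernoulli's inequality is used for \<open>1 + (1 - y)\<close> \<le>
      \<open>1 / y\<close>, so that the lower bound 1/2 on the power of \<open>y\<close> becomes the
      upper bound 2.\<close>
    have "1 + 2 ^ k * (1 - y) \<le> (1 + (1 - y)) ^ (2 ^ k)"
      using Bernoulli_inequality[of "1 - y" "2 ^ k"] \<theta>(2)[of t] by (simp add: y_def)
    also have "\<dots> \<le> (1 / y) ^ (2 ^ k)"
    proof (intro power_mono)
      have "(1 + (1 - y)) * y \<le> 1"
        using zero_le_power2[of "1 - y"] by (simp add: power2_eq_square algebra_simps)
      then show "1 + (1 - y) \<le> 1 / y"
        using y0 by (simp add: pos_le_divide_eq)
    qed (use \<theta>(2)[of t] in \<open>simp add: y_def\<close>)
    also have "\<dots> \<le> 2"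
      using \<open>1 / 2 \<le> y ^ (2 ^ k)\<close> y0 by (simp add: power_one_over field_simps)
    finally have 1: "1 - y \<le> 1 / 2 ^ k"
      by (simp add: field_simps)
    \<comment> \<open>Since \<open>c powr \<alpha> = 2\<close>, the right side is
      \<open>2 ^ m\<close>; going back from \<open>m\<close> to \<open>k\<close> costs the factor 2
      of the claim.\<close>
    have "(t0 / \<bar>t\<bar>) powr \<alpha> \<le> (c ^ m) powr \<alpha>"
      using m \<alpha> t0(1) by (intro powr_mono2) auto
    also have "\<dots> = 2 ^ m"
      using c1 \<alpha> by (simp add: c powr_powr powr_realpow[symmetric])
    finally have "(t0 / \<bar>t\<bar>) powr \<alpha> \<le> 2 * 2 ^ k" by (simp add: k)
    then have "1 / 2 ^ k \<le> 2 * t0 powr - \<alpha> * \<bar>t\<bar> powr \<alpha>"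
      using 3 t0(1) by (simp add: powr_divide powr_minus field_simps)
    with 1 show ?thesis by (simp add: y_def)
  qed
qed

text \<open>Symmetrization removes the unknown shift. The difference of two independent copies has
  characteristic function \<theta>, the squared modulus of that of \<mu>, and stability with
  \<open>a = b = 1\<close> gives \<open>\<theta> (c * t) = (\<theta> t)\<^sup>2\<close>. Hence
  \<open>1 - \<theta> t\<close> is of order \<open>\<bar>t\<bar> powr \<alpha>\<close>, and the
  truncation inequality gives the tail of the difference. The tail of \<mu> itself is recovered by
  keeping one copy in a bounded interval.\<close>

lemma stable_distribution_tail:
  assumes st: "stable_distribution \<alpha> \<mu>" and \<alpha>: "0 < \<alpha>"
  shows "\<exists>C\<ge>0. \<forall>x. x \<noteq> 0 \<longrightarrow> measure \<mu> {y. \<bar>x\<bar> \<le> \<bar>y\<bar>} \<le> C * \<bar>x\<bar> powr - \<alpha>"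
proof -
  have rd: "real_distribution \<mu>" using st by (simp add: stable_distribution_def)
  interpret real_distribution \<mu> by fact
  interpret P: pair_prob_space \<mu> \<mu> by unfold_locales
  have s [simp, measurable_cong]: "sets \<mu> = sets borel" by simp
  define c where "c = (2::real) powr (1 / \<alpha>)"
  define \<theta> where "\<theta> t = (cmod (char \<mu> t))\<^sup>2" for t
  obtain d where d: "distr (\<mu> \<Otimes>\<^sub>M \<mu>) borel (\<lambda>(u, v). 1 * u + 1 * v)
      = distr \<mu> borel (\<lambda>u. (1 powr \<alpha> + 1 powr \<alpha>) powr (1 / \<alpha>) * u + d)"
    using st unfolding stable_distribution_def by (metis zero_less_one)
  have sq: "\<theta> (c * t) = (\<theta> t)\<^sup>2" for t
  proof -
    have "char \<mu> t * char \<mu> t = iexp (t * d) * char \<mu> (c * t)"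
      using arg_cong[OF d, of "\<lambda>m. char m t"] char_distr_pair_linear[OF rd, of 1 1 t]
        char_distr_affine[OF rd, of c d t]
      by (simp add: c_def)
    then have "cmod (char \<mu> t) * cmod (char \<mu> t) = cmod (iexp (t * d)) * cmod (char \<mu> (c * t))"
      by (metis norm_mult)
    then show ?thesis by (simp add: \<theta>_def power2_eq_square)
  qed
  define \<nu> where "\<nu> = distr (\<mu> \<Otimes>\<^sub>M \<mu>) borel (\<lambda>(u, v). 1 * u + (- 1) * v)"
  interpret \<nu>: real_distribution \<nu>
    unfolding \<nu>_def by (rule P.P.real_distribution_distr) auto
  have char_\<nu>: "Re (char \<nu> t) = \<theta> t" for t
  proof -
    have "char \<mu> (- t) = cnj (char \<mu> t)"
      unfolding char_def
      by (subst Bochner_Integration.integral_cnj[symmetric], intro Bochner_Integration.integral_cong) (auto simp: exp_cnj)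
    then have "char \<nu> t = complex_of_real (\<theta> t)"
      unfolding \<nu>_def char_distr_pair_linear[OF rd] \<theta>_def
      by (simp add: complex_norm_square del: of_real_power)
    then show ?thesis by simp
  qed
  have "isCont (\<lambda>t. \<theta> t) 0"
    unfolding \<theta>_def by (intro continuous_intros isCont_char)
  then have "(\<theta> \<longlongrightarrow> 1) (at 0)"
    by (simp add: \<theta>_def[abs_def] isCont_def char_zero)
  then have "eventually (\<lambda>t. 1 / 2 < \<theta> t) (at 0)"
    by (rule order_tendstoD) simp
  then obtain t1 where t1: "0 < t1" "\<And>t. t \<noteq> 0 \<Longrightarrow> \<bar>t\<bar> < t1 \<Longrightarrow> 1 / 2 < \<theta> t"
    by (auto simp: eventually_at dist_real_def)
  define t0 where "t0 = t1 / 2"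
  have t0: "0 < t0" "1 / 2 \<le> \<theta> t" if "\<bar>t\<bar> \<le> t0" for t
    using t1(1) t1(2)[of t] that by (cases "t = 0"; auto simp: t0_def \<theta>_def char_zero)+
  have t00: "0 < t0" using t1(1) by (simp add: t0_def)
  define L where "L = 2 * t0 powr - \<alpha>"
  have L0: "0 \<le> L" by (simp add: L_def)
  have \<theta>_le: "1 - \<theta> t \<le> L * \<bar>t\<bar> powr \<alpha>" for t
    unfolding L_def
    by (rule one_minus_le_powr[where \<theta>=\<theta>, OF \<alpha> c_def _ _ sq t00 t0(2)])
      (auto simp: \<theta>_def abs_square_le_1 cmod_char_le_1)
  define C1 where "C1 = 2 * L * 2 powr \<alpha>"
  have \<nu>_tail: "\<nu>.prob {y. x \<le> \<bar>y\<bar>} \<le> C1 * x powr - \<alpha>" if x: "0 < x" for x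
  proof -
    \<comment> \<open>The cutoff \<open>u = 2 / x\<close> is chosen so that
      \<open>2 / u = x\<close>.\<close>
    have "\<nu>.prob {y. 2 / (2 / x) \<le> \<bar>y\<bar>} \<le> 2 * (L * (2 / x) powr \<alpha>)"
    proof (rule \<nu>.tail_le_char)
      fix t assume "\<bar>t\<bar> \<le> 2 / x"
      then have "L * \<bar>t\<bar> powr \<alpha> \<le> L * (2 / x) powr \<alpha>"
        using L0 \<alpha> by (intro mult_left_mono powr_mono2) auto
      with \<theta>_le[of t] show "1 - Re (char \<nu> t) \<le> L * (2 / x) powr \<alpha>"
        by (simp add: char_\<nu>)
    qed (use x in auto)
    then show ?thesis
      using x by (simp add: C1_def powr_divide powr_minus field_simps)
  qed
  obtain b where b: "0 < b" "1 / 2 \<le> prob {y. \<bar>y\<bar> < b}"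
  proof -
    have "(\<lambda>i. prob {y. \<bar>y\<bar> < real i}) \<longlonglongrightarrow> prob (\<Union>i. {y. \<bar>y\<bar> < real i})"
      by (intro finite_Lim_measure_incseq) (auto simp: incseq_def)
    moreover have "(\<Union>i. {y. \<bar>y\<bar> < real i}) = space \<mu>"
      using reals_Archimedean2 by auto
    ultimately have "(\<lambda>i. prob {y. \<bar>y\<bar> < real i}) \<longlonglongrightarrow> 1"
      by (simp add: prob_space[unfolded space_eq_univ])
    then have "eventually (\<lambda>i. 1 / 2 < prob {y. \<bar>y\<bar> < real i}) sequentially"
      by (rule order_tendstoD) simp
    then have "eventually (\<lambda>i. 1 / 2 < prob {y. \<bar>y\<bar> < real i} \<and> 0 < i) sequentially"
      using eventually_gt_at_top by (rule eventually_conj)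
    then obtain i where "1 / 2 < prob {y. \<bar>y\<bar> < real i}" "0 < i"
      by (auto simp: eventually_sequentially)
    then show thesis using that[of "real i"] by simp
  qed
  \<comment> \<open>The first entry makes the claimed bound at least 1 when
    \<open>\<bar>x\<bar>\<close> \<le> \<open>2 * b\<close>; the second comes from desymmetrization
    for larger \<open>x\<close>.\<close>
  define C where "C = max ((2 * b) powr \<alpha>) (2 * (C1 * 2 powr \<alpha>))"
  have "prob {y. \<bar>x\<bar> \<le> \<bar>y\<bar>} \<le> C * \<bar>x\<bar> powr - \<alpha>" if x: "x \<noteq> 0" for x
  proof (cases "\<bar>x\<bar> \<le> 2 * b")
    case True
    then have "\<bar>x\<bar> powr \<alpha> \<le> (2 * b) powr \<alpha>"
      using \<alpha> by (intro powr_mono2) auto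
    then have "1 \<le> (2 * b) powr \<alpha> * \<bar>x\<bar> powr - \<alpha>"
      using x by (simp add: powr_minus field_simps)
    also have "\<dots> \<le> C * \<bar>x\<bar> powr - \<alpha>"
      unfolding C_def by (intro mult_right_mono) auto
    finally show ?thesis using prob_le_1[of "{y. \<bar>x\<bar> \<le> \<bar>y\<bar>}"] by linarith
  next
    case False
    \<comment> \<open>Desymmetrization: if one copy is at least \<open>\<bar>x\<bar>\<close> >
      \<open>2 * b\<close> in modulus and the other is below \<open>b\<close>, their difference is
      at least \<open>\<bar>x\<bar> / 2\<close>.\<close>
    have "prob {y. \<bar>x\<bar> \<le> \<bar>y\<bar>} * (1 / 2) \<le> prob {y. \<bar>x\<bar> \<le> \<bar>y\<bar>} * prob {y. \<bar>y\<bar> < b}"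
      by (intro mult_left_mono b) auto
    also have "\<dots> = P.prob ({y. \<bar>x\<bar> \<le> \<bar>y\<bar>} \<times> {y. \<bar>y\<bar> < b})"
      by (simp add: measure_def emeasure_pair_measure_Times enn2real_mult)
    also have "\<dots> \<le> P.prob {w \<in> space (\<mu> \<Otimes>\<^sub>M \<mu>). \<bar>x\<bar> / 2 \<le> \<bar>fst w - snd w\<bar>}"
    proof (rule P.P.finite_measure_mono)
      show "{w \<in> space (\<mu> \<Otimes>\<^sub>M \<mu>). \<bar>x\<bar> / 2 \<le> \<bar>fst w - snd w\<bar>} \<in> sets (\<mu> \<Otimes>\<^sub>M \<mu>)"
        by measurable
      have "\<bar>x\<bar> / 2 \<le> \<bar>u - v\<bar>" if "\<bar>x\<bar> \<le> \<bar>u\<bar>" "\<bar>v\<bar> < b" for u v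
        using that False by linarith
      then show "{y. \<bar>x\<bar> \<le> \<bar>y\<bar>} \<times> {y. \<bar>y\<bar> < b} \<subseteq> {w \<in> space (\<mu> \<Otimes>\<^sub>M \<mu>). \<bar>x\<bar> / 2 \<le> \<bar>fst w - snd w\<bar>}"
        by (auto simp: space_pair_measure)
    qed
    also have "\<dots> = \<nu>.prob {y. \<bar>x\<bar> / 2 \<le> \<bar>y\<bar>}"
      unfolding \<nu>_def by (subst measure_distr) (auto intro!: arg_cong[where f="P.prob"])
    also have "\<dots> \<le> C1 * (\<bar>x\<bar> / 2) powr - \<alpha>"
      using x by (intro \<nu>_tail) auto
    also have "\<dots> = C1 * 2 powr \<alpha> * \<bar>x\<bar> powr - \<alpha>"
      by (simp add: powr_divide powr_minus field_simps)
    finally have "prob {y. \<bar>x\<bar> \<le> \<bar>y\<bar>} \<le> 2 * (C1 * 2 powr \<alpha>) * \<bar>x\<bar> powr - \<alpha>" by simp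
    also have "\<dots> \<le> C * \<bar>x\<bar> powr - \<alpha>"
      unfolding C_def by (intro mult_right_mono) auto
    finally show ?thesis .
  qed
  moreover have "0 \<le> C" by (simp add: C_def le_max_iff_disj)
  ultimately show ?thesis by auto
qed

section \<open>Bounds holding with high probability\<close>

text \<open>The failure of \<open>P n\<close> is covered by an event \<open>A\<close> instead of
  being measured, so \<open>P n\<close> need not be measurable. The event may change with
  \<open>n\<close>.\<close>

definition mostly :: "'a measure \<Rightarrow> real \<Rightarrow> (nat \<Rightarrow> 'a \<Rightarrow> bool) \<Rightarrow> bool" where
  "mostly M \<epsilon> P \<longleftrightarrow>
     (\<forall>\<^sub>F n in sequentially. \<exists>A\<in>sets M. measure M A \<le> \<epsilon> \<and> (\<forall>x\<in>space M - A. P n x))"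

lemma mostly_mono:
  assumes "mostly M \<epsilon> P" and "\<forall>\<^sub>F n in sequentially. \<forall>x\<in>space M. P n x \<longrightarrow> Q n x"
  shows "mostly M \<epsilon> Q"
  using assms unfolding mostly_def by eventually_elim blast

lemma (in finite_measure) mostly_conj:
  assumes "mostly M \<epsilon> P" and "mostly M \<delta> Q"
  shows "mostly M (\<epsilon> + \<delta>) (\<lambda>n x. P n x \<and> Q n x)"
  using assms unfolding mostly_def
proof eventually_elim
  case (elim n)
  then obtain A A' where "A \<in> sets M" "measure M A \<le> \<epsilon>" "\<forall>x\<in>space M - A. P n x"
    and "A' \<in> sets M" "measure M A' \<le> \<delta>" "\<forall>x\<in>space M - A'. Q n x"
    by blast
  then show ?case
    using measure_Un_le[of A M A'] by (intro bexI[of _ "A \<union> A'"]) auto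
qed

lemma (in finite_measure) mostly_Markov:
  fixes g :: "nat \<Rightarrow> 'a \<Rightarrow> ennreal"
  assumes \<epsilon>: "0 < \<epsilon>" and C: "0 \<le> C" and \<beta>: "\<And>n. 1 \<le> n \<Longrightarrow> 0 < \<beta> n"
    and g [measurable]: "\<And>n. 1 \<le> n \<Longrightarrow> g n \<in> borel_measurable M"
    and le: "\<And>n. 1 \<le> n \<Longrightarrow> (\<integral>\<^sup>+x. g n x \<partial>M) \<le> ennreal (C * \<beta> n)"
  shows "\<exists>K>0. mostly M \<epsilon> (\<lambda>n x. g n x \<le> ennreal (K * \<beta> n))"
proof -
  \<comment> \<open>Markov's inequality leaves the probability \<open>C / K\<close>; the summand 1
    keeps \<open>K\<close> positive when \<open>C = 0\<close>.\<close>
  define K where "K = C / \<epsilon> + 1"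
  have K: "0 < K" "C / K \<le> \<epsilon>"
  proof -
    have "0 \<le> C / \<epsilon>" using C \<epsilon> by simp
    then show "0 < K" unfolding K_def by linarith
    then show "C / K \<le> \<epsilon>" using \<epsilon> by (simp add: K_def field_simps)
  qed
  have "mostly M \<epsilon> (\<lambda>n x. g n x \<le> ennreal (K * \<beta> n))"
    unfolding mostly_def using eventually_ge_at_top[of 1]
  proof eventually_elim
    case (elim n)
    note [measurable] = g[OF elim]
    define c where "c = 1 / (K * \<beta> n)"
    have c: "0 < c" "c * (K * \<beta> n) = 1" using K \<beta>[OF elim] by (auto simp: c_def)
    define A where "A = {x \<in> space M. 1 \<le> ennreal c * g n x}"
    have "emeasure M A \<le> ennreal c * (\<integral>\<^sup>+x. g n x * indicator (space M) x \<partial>M)"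
      unfolding A_def by (rule nn_integral_Markov_inequality) auto
    also have "(\<integral>\<^sup>+x. g n x * indicator (space M) x \<partial>M) = (\<integral>\<^sup>+x. g n x \<partial>M)"
      by (intro nn_integral_cong) simp
    also have "ennreal c * \<dots> \<le> ennreal c * ennreal (C * \<beta> n)"
      by (intro mult_left_mono le elim) auto
    also have "\<dots> = ennreal (C / K)"
      using c C K \<beta>[OF elim] by (simp add: c_def flip: ennreal_mult)
    also have "\<dots> \<le> ennreal \<epsilon>"
      by (intro ennreal_leI K)
    finally have "measure M A \<le> \<epsilon>"
      using \<epsilon> by (simp add: emeasure_eq_measure)
    moreover have "g n x \<le> ennreal (K * \<beta> n)" if "x \<in> space M - A" for x
    proof -
      have "ennreal c * g n x \<le> ennreal c * ennreal (K * \<beta> n)"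
        using that c K \<beta>[OF elim] by (auto simp: A_def simp flip: ennreal_mult)
      then show ?thesis
        using c by (subst (asm) ennreal_mult_le_mult_iff) auto
    qed
    moreover have "A \<in> sets M" unfolding A_def by measurable
    ultimately show ?case by blast
  qed
  with K show ?thesis by blast
qed

text \<open>Continuity of the measure from below. In \<open>G m\<close> the same \<open>m\<close>
  serves as starting index and as bound, which gives a single increasing sequence of events whose
  union has probability 1.\<close>

lemma (in prob_space) mostly_bounded_if_limsup_finite:
  fixes V :: "nat \<Rightarrow> 'a \<Rightarrow> real"
  assumes [measurable]: "\<And>n. V n \<in> borel_measurable M"
    and fin: "AE x in M. limsup (\<lambda>n. ereal (V n x)) < \<infinity>" and \<epsilon>: "0 < \<epsilon>"
  shows "\<exists>K>0. mostly M \<epsilon> (\<lambda>n x. V n x \<le> K)"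
proof -
  define G where "G m = {x \<in> space M. \<forall>n\<ge>m. V n x \<le> real m}" for m
  have [measurable]: "G m \<in> sets M" for m unfolding G_def by measurable
  have inc: "incseq G"
  proof (intro monoI subsetI)
    fix m m' x assume "m \<le> m'" "x \<in> G m"
    then have "x \<in> space M" and le: "\<And>n. m' \<le> n \<Longrightarrow> V n x \<le> real m"
      by (auto simp: G_def)
    moreover have "real m \<le> real m'" using \<open>m \<le> m'\<close> by simp
    ultimately show "x \<in> G m'"
      unfolding G_def by (intro CollectI conjI allI impI) (auto intro: order_trans[OF le])
  qed
  have "AE x in M. x \<in> (\<Union>m. G m)"
    using fin AE_space
  proof eventually_elim
    case (elim x)
    from ereal_dense2[OF elim(1)] obtain b where b: "limsup (\<lambda>n. ereal (V n x)) < ereal b"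
      by auto
    then have "eventually (\<lambda>n. V n x < b) sequentially"
      using Limsup_lessD[OF b] by simp
    then obtain N where N: "\<And>n. N \<le> n \<Longrightarrow> V n x < b"
      by (auto simp: eventually_sequentially)
    obtain m where m: "b \<le> real m" using real_arch_simple by auto
    have "x \<in> G (max N m)"
      unfolding G_def
    proof (intro CollectI conjI allI impI elim(2))
      fix n assume "max N m \<le> n"
      then have "V n x < b" by (intro N) simp
      also note m
      also have "real m \<le> real (max N m)" by simp
      finally show "V n x \<le> real (max N m)" by simp
    qed
    then show ?case by blast
  qed
  then have "prob (\<Union>m. G m) = 1"
    by (intro prob_eq_1[THEN iffD2]) auto
  moreover have "(\<lambda>m. prob (G m)) \<longlonglongrightarrow> prob (\<Union>m. G m)"
    using inc by (intro finite_Lim_measure_incseq) auto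
  ultimately have "eventually (\<lambda>m. 1 - \<epsilon> < prob (G m)) sequentially"
    using \<epsilon> by (intro order_tendstoD(1)[where y=1]) auto
  then obtain m where m: "1 - \<epsilon> < prob (G m)"
    by (auto simp: eventually_sequentially)
  \<comment> \<open>Adding 1 keeps the constant positive when \<open>m = 0\<close>.\<close>
  have "mostly M \<epsilon> (\<lambda>n x. V n x \<le> real m + 1)"
    unfolding mostly_def using eventually_ge_at_top[of m]
  proof eventually_elim
    case (elim n)
    have "prob (space M - G m) \<le> \<epsilon>" using m by (simp add: prob_compl)
    moreover have "V n x \<le> real m + 1" if "x \<in> space M - (space M - G m)" for x
    proof -
      have "V n x \<le> real m" using that elim by (simp add: G_def)
      then show ?thesis by simp
    qed
    ultimately show ?case by (intro bexI[of _ "space M - G m"]) auto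
  qed
  then show ?thesis by (intro exI[of _ "real m + 1"]) auto
qed

text \<open>A weak law of large numbers for a triangular array: each row is i.i.d., while different
  rows may be related arbitrarily. It follows from the mean error of order
  \<open>n powr (- 1 / 2)\<close> and Markov's inequality.\<close>

lemma (in prob_space) mostly_mean_near:
  fixes \<zeta> :: "nat \<Rightarrow> nat \<Rightarrow> 'a \<Rightarrow> real" and f :: "real \<Rightarrow> real"
  assumes indep: "\<And>n. 1 \<le> n \<Longrightarrow> indep_vars (\<lambda>_. borel) (\<zeta> n) {1..n}"
    and law: "\<And>n k. 1 \<le> n \<Longrightarrow> k \<in> {1..n} \<Longrightarrow> distr M borel (\<zeta> n k) = \<mu>"
    and f [measurable]: "f \<in> borel_measurable borel" and bnd: "\<And>x. \<bar>f x\<bar> \<le> B"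
    and \<epsilon>: "0 < \<epsilon>" and \<delta>: "0 < \<delta>"
  shows "mostly M \<epsilon> (\<lambda>n x. \<bar>(\<Sum>k=1..n. f (\<zeta> n k x)) / real n - (\<integral>y. f y \<partial>\<mu>)\<bar> \<le> \<delta>)"
proof -
  define m where "m = (\<integral>y. f y \<partial>\<mu>)"
  define V where "V = (B + \<bar>m\<bar>)\<^sup>2"
  have B0: "0 \<le> B" using bnd[of 0] by linarith
  have \<zeta> [measurable]: "\<zeta> n k \<in> borel_measurable M" if "1 \<le> n" "k \<in> {1..n}" for n k
    using indep[OF that(1)] that(2) by (auto simp: indep_vars_def)
  have bound: "(\<integral>\<^sup>+x. ennreal \<bar>(\<Sum>k=1..n. f (\<zeta> n k x)) / real n - m\<bar> \<partial>M) \<le> ennreal (sqrt V * real n powr (- 1 / 2))"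
    if n: "1 \<le> n" for n
  proof -
    have [measurable]: "\<zeta> n k \<in> borel_measurable M" if "k \<in> {1..n}" for k
      using \<zeta>[OF n that] .
    have int: "integrable M (\<lambda>x. f (\<zeta> n k x))" if "k \<in> {1..n}" for k
      using that bnd by (intro integrable_const_bound[of _ B]) auto
    have mean: "expectation (\<lambda>x. f (\<zeta> n k x)) = m" if "k \<in> {1..n}" for k
      using that unfolding m_def law[OF n that, symmetric] by (subst integral_distr) auto
    have "expectation (\<lambda>x. \<bar>(\<Sum>k=1..n. f (\<zeta> n k x)) / real n - m\<bar>) \<le> sqrt (V / real n)"
    proof (rule expectation_abs_mean_deviation[OF n _ bnd mean])
      show "indep_vars (\<lambda>_. borel) (\<lambda>k x. f (\<zeta> n k x)) {1..n}"
        using indep[OF n] by (rule indep_vars_compose2) auto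
      fix k assume k: "k \<in> {1..n}"
      have V: "(f (\<zeta> n k x) - m)\<^sup>2 \<le> V" for x
        unfolding V_def using bnd[of "\<zeta> n k x"] B0 by (intro power2_le_iff_abs_le[THEN iffD2]) auto
      have "expectation (\<lambda>x. (f (\<zeta> n k x) - m)\<^sup>2) \<le> expectation (\<lambda>x. V)"
        using k V by (intro integral_mono integrable_const_bound[of _ V]) (auto simp: V_def)
      then show "expectation (\<lambda>x. (f (\<zeta> n k x) - m)\<^sup>2) \<le> V" by (simp add: prob_space)
    qed
    also have "sqrt (V / real n) = sqrt V * real n powr (- 1 / 2)"
      using n by (simp add: real_sqrt_divide powr_minus_divide powr_half_sqrt)
    finally show ?thesis
      by (subst nn_integral_eq_integral)
        (auto intro!: ennreal_leI integrable_abs Bochner_Integration.integrable_diff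
          Bochner_Integration.integrable_divide_zero Bochner_Integration.integrable_sum int)
  qed
  have meas: "(\<lambda>x. ennreal \<bar>(\<Sum>k=1..n. f (\<zeta> n k x)) / real n - m\<bar>) \<in> borel_measurable M"
    if "1 \<le> n" for n
  proof -
    have [measurable]: "\<zeta> n k \<in> borel_measurable M" if "k \<in> {1..n}" for k
      using \<zeta>[OF \<open>1 \<le> n\<close> that] .
    show ?thesis by measurable
  qed
  have "\<exists>K>0. mostly M \<epsilon> (\<lambda>n x. ennreal \<bar>(\<Sum>k=1..n. f (\<zeta> n k x)) / real n - m\<bar> \<le> ennreal (K * real n powr (- 1 / 2)))"
    by (rule mostly_Markov[OF \<epsilon>, of "sqrt V"]) (use meas bound in \<open>auto simp: V_def\<close>)
  then obtain K where K: "0 < K"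
    "mostly M \<epsilon> (\<lambda>n x. ennreal \<bar>(\<Sum>k=1..n. f (\<zeta> n k x)) / real n - m\<bar> \<le> ennreal (K * real n powr (- 1 / 2)))"
    by blast
  have "(\<lambda>n. K * real n powr (- 1 / 2)) \<longlonglongrightarrow> K * 0"
    by (intro tendsto_mult tendsto_const tendsto_neg_powr filterlim_real_sequentially) auto
  then have "eventually (\<lambda>n. K * real n powr (- 1 / 2) < \<delta>) sequentially"
    using \<delta> by (intro order_tendstoD(2)) auto
  then show ?thesis
    unfolding m_def[symmetric]
    by (intro mostly_mono[OF K(2)], eventually_elim) (use K(1) in auto)
qed

text \<open>The proxies are close to the sorted increments only in mean absolute distance, and the
  normalizing function \<open>h\<close> is merely continuous; a Lipschitz function below it
  transfers a lower bound from one sample to the other. The candidate is the distance to the closed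
  set where \<open>h\<close> \<le> \<open>1 / (j + 1)\<close>, cut off at that level. If all
  candidates had integral 0, almost every point would lie in all these sets, so \<open>h\<close>
  would vanish almost everywhere.\<close>

lemma Lipschitz_minorant:
  fixes h :: "real \<Rightarrow> real"
  assumes "real_distribution \<mu>" and h: "continuous_on UNIV h" "\<And>x. 0 \<le> h x" "h 0 = 0"
    and pos: "0 < (\<integral>x. h x \<partial>\<mu>)"
  shows "\<exists>l. (\<forall>x. 0 \<le> l x \<and> l x \<le> h x \<and> l x \<le> 1) \<and> (\<forall>x y. \<bar>l x - l y\<bar> \<le> \<bar>x - y\<bar>) \<and> 0 < (\<integral>x. l x \<partial>\<mu>)"
proof -
  interpret \<mu>: real_distribution \<mu> by fact
  define l where "l j x = min (1 / real (Suc j)) (infdist x {y. h y \<le> 1 / real (Suc j)})" for j x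
  have ne: "{y. h y \<le> 1 / real (Suc j)} \<noteq> {}" for j
    using h(3) by (intro ex_in_conv[THEN iffD1] exI[of _ 0]) simp
  have closed: "closed {y. h y \<le> 1 / real (Suc j)}" for j
    using h(1) by (intro closed_Collect_le) auto
  have l0: "0 \<le> l j x" for j x unfolding l_def by (simp add: infdist_nonneg)
  have lh: "l j x \<le> h x" for j x
    using h(2)[of x] by (cases "h x \<le> 1 / real (Suc j)") (auto simp: l_def)
  have l1: "l j x \<le> 1" for j x unfolding l_def by (simp add: min_le_iff_disj)
  have lip: "\<bar>l j x - l j y\<bar> \<le> \<bar>x - y\<bar>" for j x y
    using infdist_triangle_abs[of x "{y. h y \<le> 1 / real (Suc j)}" y]
    unfolding l_def dist_real_def by linarith
  have cont: "continuous_on UNIV (l j)" for j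
    unfolding l_def by (intro continuous_intros)
  have [measurable]: "l j \<in> borel_measurable borel" for j
    using cont by (rule borel_measurable_continuous_onI)
  have int: "integrable \<mu> (l j)" for j
    by (rule \<mu>.integrable_const_bound[of _ 1]) (use l0 l1 in \<open>auto simp: abs_le_iff\<close>)
  have "\<exists>j. 0 < (\<integral>x. l j x \<partial>\<mu>)"
  proof (rule ccontr)
    assume "\<not> ?thesis"
    then have "(\<integral>x. l j x \<partial>\<mu>) = 0" for j
      using Bochner_Integration.integral_nonneg[of \<mu> "l j"] l0 by (metis antisym_conv2 order.refl linorder_not_less)
    then have "AE x in \<mu>. l j x = 0" for j
      using integral_nonneg_eq_0_iff_AE[OF int] l0 by blast
    then have "AE x in \<mu>. \<forall>j. l j x = 0"
      by (simp add: AE_all_countable)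
    then have "AE x in \<mu>. h x = 0"
    proof eventually_elim
      case (elim x)
      have "h x \<le> 1 / real (Suc j)" for j
      proof -
        have "infdist x {y. h y \<le> 1 / real (Suc j)} = 0"
          using elim by (auto simp: l_def min_def split: if_splits)
        then show ?thesis
          using in_closed_iff_infdist_zero[OF closed ne] by blast
      qed
      then have "h x \<le> 0"
        by (metis linorder_not_less nat_approx_posE order_less_le_trans less_irrefl)
      with h(2)[of x] show ?case by simp
    qed
    then have "(\<integral>x. h x \<partial>\<mu>) = 0" by (rule integral_eq_zero_AE)
    with pos show False by simp
  qed
  then show ?thesis using l0 lh l1 lip by blast
qed

section \<open>Increments of the self-similar process\<close>

text \<open>Needed because \<open>levy_process\<close> numbers increments from 0, while samples are
  numbered from 1.\<close>

lemma (in prob_space) indep_vars_reindex: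
  assumes f: "inj_on f I" and indep: "indep_vars N X (f ` I)"
  shows "indep_vars (\<lambda>i. N (f i)) (\<lambda>i. X (f i)) I"
  unfolding indep_vars_def2
proof (intro conjI ballI)
  show "random_variable (N (f i)) (X (f i))" if "i \<in> I" for i
    using indep that by (auto simp: indep_vars_def)
  define F where "F j = {X j -` A \<inter> space M |A. A \<in> sets (N j)}" for j
  have F: "indep_sets F (f ` I)"
    using indep unfolding indep_vars_def2 F_def by simp
  have "indep_sets (\<lambda>i. F (f i)) I"
    unfolding indep_sets_def
  proof (intro conjI ballI allI impI)
    show "F (f i) \<subseteq> events" if "i \<in> I" for i
      using F that by (auto simp: indep_sets_def)
    fix J A assume J: "J \<subseteq> I" "J \<noteq> {}" "finite J" and A: "A \<in> Pi J (\<lambda>i. F (f i))"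
    have inj: "inj_on f J" using f J(1) by (rule inj_on_subset)
    define A' where "A' = A \<circ> the_inv_into J f"
    have A': "A' (f i) = A i" if "i \<in> J" for i
      using that by (simp add: A'_def the_inv_into_f_f[OF inj])
    have "prob (\<Inter>j\<in>f ` J. A' j) = (\<Prod>j\<in>f ` J. prob (A' j))"
      using J A A' by (intro indep_setsD[OF F]) auto
    then show "prob (\<Inter>i\<in>J. A i) = (\<Prod>i\<in>J. prob (A i))"
      by (simp add: prod.reindex[OF inj] A' cong: INF_cong)
  qed
  then show "indep_sets (\<lambda>i. {X (f i) -` A \<inter> space M |A. A \<in> sets (N (f i))}) I"
    by (simp add: F_def)
qed

text \<open>Independence is that of the increments over the grid. For the law, stationarity replaces
  the increment by \<open>Z (T / n)\<close>, and self-similarity produces a factor that the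
  prefactor \<open>(T / n) powr (- 1 / \<alpha>)\<close> cancels.\<close>

lemma (in prob_space) scaled_increment_iid:
  assumes levy: "levy_process M Z" and ss: "self_similar M (1 / \<alpha>) Z" and T: "0 < T" and n: "1 \<le> n"
  shows "indep_vars (\<lambda>_. borel) (scaled_increment \<alpha> T Z n) {1..n}"
    and "k \<in> {1..n} \<Longrightarrow> distr M borel (scaled_increment \<alpha> T Z n k) = distr M borel (Z 1)"
proof -
  define c where "c = T / real n"
  have c: "0 < c" using T n by (simp add: c_def)
  have Z [measurable]: "Z t \<in> borel_measurable M" if "0 \<le> t" for t
    using levy that by (simp add: levy_process_def)
  define \<tau> where "\<tau> i = T * real i / real n" for i
  have "0 \<le> \<tau> 0 \<and> (\<forall>i<n. \<tau> i \<le> \<tau> (Suc i))"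
    using T by (auto simp: \<tau>_def intro!: divide_right_mono mult_left_mono)
  then have ind: "indep_vars (\<lambda>_. borel) (\<lambda>i x. Z (\<tau> (Suc i)) x - Z (\<tau> i) x) {..<n}"
    using levy unfolding levy_process_def by blast
  have img: "(\<lambda>k. k - 1) ` {1..n} = {..<n}"
  proof (intro equalityI subsetI)
    fix i assume "i \<in> {..<n}"
    then show "i \<in> (\<lambda>k. k - 1) ` {1..n}" by (intro image_eqI[of _ _ "Suc i"]) auto
  qed auto
  have inj: "inj_on (\<lambda>k. k - 1) {1..n}" by (auto simp: inj_on_def)
  have "indep_vars (\<lambda>_. borel) (\<lambda>k x. Z (\<tau> (Suc (k - 1))) x - Z (\<tau> (k - 1)) x) {1..n}"
    by (rule indep_vars_reindex[OF inj]) (unfold img, rule ind)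
  then have "indep_vars (\<lambda>_. borel) (\<lambda>k x. c powr (- 1 / \<alpha>) * (Z (\<tau> (Suc (k - 1))) x - Z (\<tau> (k - 1)) x)) {1..n}"
    by (rule indep_vars_compose2) auto
  then show "indep_vars (\<lambda>_. borel) (scaled_increment \<alpha> T Z n) {1..n}"
    by (rule indep_vars_cong[THEN iffD1, rotated -1])
      (auto simp: scaled_increment_def \<tau>_def c_def of_nat_diff fun_eq_iff)
  assume k: "k \<in> {1..n}"
  define s where "s = T * (real k - 1) / real n"
  have s: "0 \<le> s" "s + c = T * real k / real n"
    using T k n by (auto simp: s_def c_def field_simps)
  have inc: "distr M borel (\<lambda>x. Z (s + c) x - Z s x) = distr M borel (Z c)"
    using levy s(1) less_imp_le[OF c] unfolding levy_process_def by blast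
  \<comment> \<open>The finite-dimensional identity for the time set {1}; projecting to its
    coordinate then identifies the law of \<open>Z c\<close>.\<close>
  have "distr M (Pi\<^sub>M {1} (\<lambda>_. borel)) (\<lambda>x. \<lambda>t\<in>{1}. Z (c * t) x)
      = distr M (Pi\<^sub>M {1} (\<lambda>_. borel)) (\<lambda>x. \<lambda>t\<in>{1}. c powr (1 / \<alpha>) * Z t x)"
    using ss c unfolding self_similar_def same_fdd_def by simp
  then have "distr (distr M (Pi\<^sub>M {1} (\<lambda>_. borel)) (\<lambda>x. \<lambda>t\<in>{1}. Z (c * t) x)) borel (\<lambda>f. f 1)
      = distr (distr M (Pi\<^sub>M {1} (\<lambda>_. borel)) (\<lambda>x. \<lambda>t\<in>{1}. c powr (1 / \<alpha>) * Z t x)) borel (\<lambda>f. f (1::real))"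
    by simp
  then have scal: "distr M borel (Z c) = distr M borel (\<lambda>x. c powr (1 / \<alpha>) * Z 1 x)"
    using c by (simp add: distr_distr comp_def)
  have "distr M borel (scaled_increment \<alpha> T Z n k) = distr (distr M borel (\<lambda>x. Z (s + c) x - Z s x)) borel ((*) (c powr (- 1 / \<alpha>)))"
    using s c by (subst distr_distr) (auto simp: comp_def scaled_increment_def[abs_def] s_def c_def)
  also have "\<dots> = distr (distr M borel (\<lambda>x. c powr (1 / \<alpha>) * Z 1 x)) borel ((*) (c powr (- 1 / \<alpha>)))"
    unfolding inc scal ..
  also have "\<dots> = distr M borel (Z 1)"
    using c by (subst distr_distr) (auto simp: comp_def mult.assoc[symmetric] powr_add[symmetric])
  finally show "distr M borel (scaled_increment \<alpha> T Z n k) = distr M borel (Z 1)" .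
qed

section \<open>Rates for i.i.d. samples and for the proxies\<close>

text \<open>The mean distance is at most the integral of \<open>tail_bound\<close>, whose scaling in
  the sample size gives the rate; Markov's inequality finishes. It serves for the increments and for
  the auxiliary sample.\<close>

lemma (in prob_space) mostly_cdf_dist_iid:
  assumes law: "real_distribution \<mu>"
    and tail: "\<And>x. x \<noteq> 0 \<Longrightarrow> cdf \<mu> x \<le> C * \<bar>x\<bar> powr - \<alpha> \<or> 1 - cdf \<mu> x \<le> C * \<bar>x\<bar> powr - \<alpha>"
    and C: "0 \<le> C" and \<alpha>: "1 < \<alpha>" "\<alpha> < 2" and \<epsilon>: "0 < \<epsilon>"
    and indep: "\<And>n. 1 \<le> n \<Longrightarrow> indep_vars (\<lambda>_. borel) (\<zeta> n) {1..n}"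
    and distr: "\<And>n k. 1 \<le> n \<Longrightarrow> k \<in> {1..n} \<Longrightarrow> distr M borel (\<zeta> n k) = \<mu>"
  shows "\<exists>K>0. mostly M \<epsilon> (\<lambda>n x. cdf_dist (ecdf n (\<lambda>k. \<zeta> n k x)) (cdf \<mu>)
    \<le> ennreal (K * real n powr (1 / \<alpha> - 1)))"
proof -
  interpret \<mu>: real_distribution \<mu> by fact
  define I where "I = enn2real (\<integral>\<^sup>+x. ennreal (tail_bound C \<alpha> 1 x) \<partial>lborel)"
  have I: "(\<integral>\<^sup>+x. ennreal (tail_bound C \<alpha> 1 x) \<partial>lborel) = ennreal I"
    unfolding I_def using nn_integral_tail_bound_finite[OF \<alpha> C] by simp
  have I0: "0 \<le> I" by (simp add: I_def)
  have meas: "cdf \<mu> \<in> borel_measurable borel"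
    by (intro borel_measurable_mono monoI \<mu>.cdf_nondecreasing)
  define g where "g n x = cdf_dist (ecdf n (\<lambda>k. \<zeta> n k x)) (cdf \<mu>)" for n x
  have g: "g n \<in> borel_measurable M"
    "(\<integral>\<^sup>+x. g n x \<partial>M) \<le> ennreal (I * real n powr (1 / \<alpha> - 1))" if n: "1 \<le> n" for n
  proof -
    note bound = nn_integral_cdf_dist_ecdf[where C=C and \<alpha>=\<alpha>, OF n indep[OF n] distr[OF n] meas]
    show "g n \<in> borel_measurable M"
      unfolding g_def[abs_def] by (rule bound(1)[OF _ tail])
    have "(\<integral>\<^sup>+x. g n x \<partial>M) \<le> (\<integral>\<^sup>+x. ennreal (tail_bound C \<alpha> (real n) x) \<partial>lborel)"
      unfolding g_def by (rule bound(2)[OF _ tail])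
    also have "\<dots> = ennreal (I * real n powr (1 / \<alpha> - 1))"
      using \<alpha> n by (subst nn_integral_tail_bound) (auto simp: I I0 ennreal_mult mult.commute)
    finally show "(\<integral>\<^sup>+x. g n x \<partial>M) \<le> ennreal (I * real n powr (1 / \<alpha> - 1))" .
  qed
  have "\<exists>K>0. mostly M \<epsilon> (\<lambda>n x. g n x \<le> ennreal (K * real n powr (1 / \<alpha> - 1)))"
    by (rule mostly_Markov[OF \<epsilon>, where C=I]) (auto simp: I0 g)
  then show ?thesis by (simp only: g_def)
qed

lemma cdf_dist_quantile_le:
  assumes "real_distribution \<mu>" and n: "1 \<le> n"
    and tail: "\<And>x. x \<noteq> 0 \<Longrightarrow> cdf \<mu> x \<le> C * \<bar>x\<bar> powr - \<alpha> \<or> 1 - cdf \<mu> x \<le> C * \<bar>x\<bar> powr - \<alpha>"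
  shows "cdf_dist (ecdf n (\<lambda>k. quantile (cdf \<mu>) (real k / (real n + 1)))) (cdf \<mu>)
    \<le> (\<integral>\<^sup>+x. ennreal (tail_bound C \<alpha> (real n) x) \<partial>lborel)"
  unfolding cdf_dist_def tail_bound_def
proof (rule nn_integral_mono_AE)
  show "AE x in lborel. ennreal \<bar>ecdf n (\<lambda>k. quantile (cdf \<mu>) (real k / (real n + 1))) x - cdf \<mu> x\<bar>
      \<le> ennreal (min (2 * (C * \<bar>x\<bar> powr - \<alpha>)) (sqrt (C * \<bar>x\<bar> powr - \<alpha> / real n)))"
    using AE_lborel_singleton[of 0]
    by eventually_elim (intro ennreal_leI ecdf_quantile_diff_le[OF assms(1) n] tail)
qed

lemma ecdf_cong: "(\<And>k. k \<in> {1..n} \<Longrightarrow> a k = b k) \<Longrightarrow> ecdf n a = ecdf n b"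
  unfolding ecdf_def[abs_def] by (intro ext arg_cong2[where f="(/)"] sum.cong) auto

text \<open>Monotonicity is what allows \<open>cdf_dist_ecdf_mono\<close> to be applied to the
  proxy.\<close>

lemma mono_on_proxy:
  assumes law: "real_distribution \<mu>"
    and proxy: "deterministic_proxy (cdf \<mu>) \<psi> \<or> random_proxy M X Z (cdf \<mu>) \<psi>"
    and n: "1 \<le> n" and x: "x \<in> space M"
  shows "mono_on {1..n} (\<lambda>k. \<psi> n k x)"
  using proxy
proof
  assume d: "deterministic_proxy (cdf \<mu>) \<psi>"
  show ?thesis
  proof (rule mono_onI)
    fix i j :: nat assume ij: "i \<in> {1..n}" "j \<in> {1..n}" "i \<le> j"
    define q where "q = quantile (cdf \<mu>) (real j / (real n + 1))"
    have "real j / (real n + 1) \<le> cdf \<mu> q"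
      using ij by (subst quantile_le_iff[OF law, symmetric]) (auto simp: q_def)
    moreover have "real i / (real n + 1) \<le> real j / (real n + 1)"
      using ij by (intro divide_right_mono) auto
    ultimately have "quantile (cdf \<mu>) (real i / (real n + 1)) \<le> q"
      using ij by (subst quantile_le_iff[OF law]) auto
    then show "\<psi> n i x \<le> \<psi> n j x"
      using d n ij by (simp add: deterministic_proxy_def q_def)
  qed
next
  assume "random_proxy M X Z (cdf \<mu>) \<psi>"
  then obtain \<xi> where "\<And>k. k \<in> {1..n} \<Longrightarrow> \<psi> n k x = order_stat n (\<lambda>j. \<xi> n j x) k"
    using n x unfolding random_proxy_def by blast
  then show ?thesis
    using mono_on_order_stat[of n "\<lambda>j. \<xi> n j x"] by (simp add: mono_on_def)
qed

text \<open>For the deterministic proxy the bound is sure and the exceptional event is empty. The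
  random proxy has the same empirical distribution function as the unsorted auxiliary
  sample.\<close>

lemma (in prob_space) mostly_cdf_dist_proxy:
  assumes law: "real_distribution \<mu>"
    and tail: "\<And>x. x \<noteq> 0 \<Longrightarrow> cdf \<mu> x \<le> C * \<bar>x\<bar> powr - \<alpha> \<or> 1 - cdf \<mu> x \<le> C * \<bar>x\<bar> powr - \<alpha>"
    and C: "0 \<le> C" and \<alpha>: "1 < \<alpha>" "\<alpha> < 2" and \<epsilon>: "0 < \<epsilon>"
    and proxy: "deterministic_proxy (cdf \<mu>) \<psi> \<or> random_proxy M X Z (cdf \<mu>) \<psi>"
  shows "\<exists>K>0. mostly M \<epsilon> (\<lambda>n x. cdf_dist (ecdf n (\<lambda>k. \<psi> n k x)) (cdf \<mu>)
    \<le> ennreal (K * real n powr (1 / \<alpha> - 1)))"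
  using proxy
proof
  assume d: "deterministic_proxy (cdf \<mu>) \<psi>"
  define I where "I = enn2real (\<integral>\<^sup>+x. ennreal (tail_bound C \<alpha> 1 x) \<partial>lborel)"
  have I: "(\<integral>\<^sup>+x. ennreal (tail_bound C \<alpha> 1 x) \<partial>lborel) = ennreal I"
    unfolding I_def using nn_integral_tail_bound_finite[OF \<alpha> C] by simp
  have I0: "0 \<le> I" by (simp add: I_def)
  have le: "cdf_dist (ecdf n (\<lambda>k. \<psi> n k x)) (cdf \<mu>) \<le> ennreal ((I + 1) * real n powr (1 / \<alpha> - 1))"
    if n: "1 \<le> n" for n x
  proof -
    have "ecdf n (\<lambda>k. \<psi> n k x) = ecdf n (\<lambda>k. quantile (cdf \<mu>) (real k / (real n + 1)))"
      using d n by (intro ecdf_cong) (simp add: deterministic_proxy_def)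
    then have "cdf_dist (ecdf n (\<lambda>k. \<psi> n k x)) (cdf \<mu>) \<le> (\<integral>\<^sup>+x. ennreal (tail_bound C \<alpha> (real n) x) \<partial>lborel)"
      using cdf_dist_quantile_le[OF law n tail] by simp
    also have "\<dots> = ennreal (I * real n powr (1 / \<alpha> - 1))"
      using \<alpha> n I0 by (subst nn_integral_tail_bound) (auto simp: I ennreal_mult mult.commute)
    also have "\<dots> \<le> ennreal ((I + 1) * real n powr (1 / \<alpha> - 1))"
      by (intro ennreal_leI mult_right_mono) auto
    finally show ?thesis .
  qed
  have "mostly M \<epsilon> (\<lambda>n x. cdf_dist (ecdf n (\<lambda>k. \<psi> n k x)) (cdf \<mu>) \<le> ennreal ((I + 1) * real n powr (1 / \<alpha> - 1)))"
    unfolding mostly_def using eventually_ge_at_top[of 1]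
    by eventually_elim (use le \<epsilon> in \<open>auto intro!: bexI[of _ "{}"]\<close>)
  then show ?thesis using I0 by (intro exI[of _ "I + 1"]) auto
next
  assume "random_proxy M X Z (cdf \<mu>) \<psi>"
  then obtain \<xi> where indep: "\<And>n. 1 \<le> n \<Longrightarrow> indep_vars (\<lambda>_. borel) (\<xi> n) {1..n}"
    and cdf: "\<And>n k. 1 \<le> n \<Longrightarrow> k \<in> {1..n} \<Longrightarrow> cdf (distr M borel (\<xi> n k)) = cdf \<mu>"
    and \<psi>: "\<And>n k x. 1 \<le> n \<Longrightarrow> k \<in> {1..n} \<Longrightarrow> x \<in> space M \<Longrightarrow> \<psi> n k x = order_stat n (\<lambda>j. \<xi> n j x) k"
    unfolding random_proxy_def by blast
  have distr: "distr M borel (\<xi> n k) = \<mu>" if "1 \<le> n" "k \<in> {1..n}" for n k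
  proof (rule cdf_unique[OF _ law cdf[OF that]])
    have "random_variable borel (\<xi> n k)"
      using indep[OF that(1)] that(2) by (auto simp: indep_vars_def)
    then show "real_distribution (distr M borel (\<xi> n k))"
      by (rule real_distribution_distr)
  qed
  obtain K where K: "0 < K" and m: "mostly M \<epsilon> (\<lambda>n x. cdf_dist (ecdf n (\<lambda>k. \<xi> n k x)) (cdf \<mu>)
      \<le> ennreal (K * real n powr (1 / \<alpha> - 1)))"
    using mostly_cdf_dist_iid[OF law tail C \<alpha> \<epsilon> indep distr] by blast
  have "ecdf n (\<lambda>k. \<psi> n k x) = ecdf n (\<lambda>k. \<xi> n k x)" if "1 \<le> n" "x \<in> space M" for n x
    using that \<psi> ecdf_order_stat by (metis (no_types, lifting) ecdf_cong)
  then have "mostly M \<epsilon> (\<lambda>n x. cdf_dist (ecdf n (\<lambda>k. \<psi> n k x)) (cdf \<mu>)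
      \<le> ennreal (K * real n powr (1 / \<alpha> - 1)))"
    by (intro mostly_mono[OF m] eventually_mono[OF eventually_ge_at_top[of 1]]) simp
  with K show ?thesis by blast
qed

text \<open>A variant of Hoelder's inequality that is linear in the sum of powers. Each term is
  either at most \<open>t\<close> or at most \<open>t powr (1 - p) * \<bar>b\<bar> powr p\<close>,
  and the threshold \<open>t = n powr (- 1 / p)\<close> balances the two parts, since then
  \<open>t powr (1 - p) = n * t\<close>.\<close>

lemma mean_abs_le_powr:
  assumes p: "1 \<le> p" and n: "1 \<le> n"
  shows "(\<Sum>k=1..n. \<bar>a k\<bar>) / real n \<le> real n powr (- 1 / p) * (1 + (\<Sum>k=1..n. \<bar>a k\<bar> powr p))"
proof -
  define t where "t = real n powr (- 1 / p)"
  have t: "0 < t" using n by (simp add: t_def)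
  have "\<bar>b\<bar> \<le> t + t powr (1 - p) * \<bar>b\<bar> powr p" for b
  proof (cases "\<bar>b\<bar> \<le> t")
    case True
    then show ?thesis by (simp add: add_increasing2)
  next
    case False
    then have "t powr (p - 1) \<le> \<bar>b\<bar> powr (p - 1)"
      using t p by (intro powr_mono2) auto
    then have "t powr (1 - p) * t powr (p - 1) * \<bar>b\<bar> \<le> t powr (1 - p) * \<bar>b\<bar> powr (p - 1) * \<bar>b\<bar>"
      by (intro mult_right_mono mult_left_mono) auto
    also have "t powr (1 - p) * t powr (p - 1) = 1"
      using t by (simp flip: powr_add)
    also have "t powr (1 - p) * \<bar>b\<bar> powr (p - 1) * \<bar>b\<bar> = t powr (1 - p) * \<bar>b\<bar> powr p"
      using False t by (simp add: mult.assoc powr_mult_base powr_diff)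
    finally show ?thesis using t by linarith
  qed
  then have "(\<Sum>k=1..n. \<bar>a k\<bar>) \<le> (\<Sum>k=1..n. t + t powr (1 - p) * \<bar>a k\<bar> powr p)"
    by (intro sum_mono)
  also have "\<dots> = real n * t + t powr (1 - p) * (\<Sum>k=1..n. \<bar>a k\<bar> powr p)"
    by (simp add: sum.distrib sum_distrib_left)
  also have "t powr (1 - p) = real n * t"
  proof -
    have "- 1 / p * (1 - p) = 1 + - 1 / p" using p by (simp add: field_simps)
    then have "t powr (1 - p) = real n powr (1 + - 1 / p)"
      by (simp only: t_def powr_powr)
    also have "\<dots> = real n * t"
      unfolding t_def powr_add using n by simp
    finally show ?thesis .
  qed
  finally have "(\<Sum>k=1..n. \<bar>a k\<bar>) \<le> (t * (1 + (\<Sum>k=1..n. \<bar>a k\<bar> powr p))) * real n"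
    by (simp add: algebra_simps)
  then show ?thesis
    unfolding t_def[symmetric] using n by (subst pos_divide_le_eq) auto
qed

section \<open>The pathwise error bound for a minimizer\<close>

text \<open>The mean of \<open>l\<close> over \<open>z\<close> is at least \<open>3 * m / 4\<close>;
  replacing the sorted \<open>z\<close> by \<open>q\<close> costs at most \<open>d2\<close> \<le>
  \<open>m / 4\<close> by the Lipschitz property, so the normalizing mean is at least
  \<open>m / 2\<close>. The residuals at \<sigma> are split at the sorted sample
  \<open>\<sigma> * z\<close>, which gives \<open>d1 + \<sigma> * d2\<close>.\<close>

lemma scale_estimator_error_le:
  assumes n: "1 \<le> n" and r: "r \<in> {1, 2}"
    and \<omega>: "\<And>x. \<omega> x \<in> {0..1}" and B: "\<And>x. \<bar>x\<bar> ^ (2 * r) * \<omega> x \<le> B"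
    and s: "is_arg_min (scale_objective r \<omega> n v q) (\<lambda>_. True) s"
    and l: "\<And>x. l x \<le> \<bar>x\<bar> ^ r * \<omega> x" "\<And>x y. \<bar>l x - l y\<bar> \<le> \<bar>x - y\<bar>"
    and m: "0 < m" "\<bar>(\<Sum>k=1..n. l (z k)) / real n - m\<bar> \<le> m / 4"
    and \<sigma>: "0 < \<sigma>"
    and d1: "(\<Sum>k=1..n. \<bar>v k - \<sigma> * z k\<bar>) / real n \<le> d1"
    and d2: "(\<Sum>k=1..n. \<bar>order_stat n z k - q k\<bar>) / real n \<le> d2" "d2 \<le> m / 4"
  shows "\<bar>s - \<sigma>\<bar> \<le> 2 * max 2 B / m * (d1 + \<sigma> * d2)"
proof -
  have n0: "0 < real n" using n by simp
  have "(\<Sum>k=1..n. l (z k)) = (\<Sum>k=1..n. l (order_stat n z k))"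
    by (rule sum_order_stat[symmetric])
  also have "\<dots> \<le> (\<Sum>k=1..n. l (q k) + \<bar>order_stat n z k - q k\<bar>)"
  proof (intro sum_mono)
    fix k
    show "l (order_stat n z k) \<le> l (q k) + \<bar>order_stat n z k - q k\<bar>"
      using l(2)[of "order_stat n z k" "q k"] by linarith
  qed
  also have "\<dots> \<le> (\<Sum>k=1..n. \<omega> (q k) * \<bar>q k\<bar> ^ r + \<bar>order_stat n z k - q k\<bar>)"
    using l(1) by (intro sum_mono add_right_mono) (simp add: mult.commute)
  finally have "(\<Sum>k=1..n. l (z k)) / real n
      \<le> (\<Sum>k=1..n. \<omega> (q k) * \<bar>q k\<bar> ^ r) / real n + (\<Sum>k=1..n. \<bar>order_stat n z k - q k\<bar>) / real n"
    unfolding sum.distrib add_divide_distrib[symmetric] by (intro divide_right_mono) auto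
  then have low: "m / 2 \<le> (\<Sum>k=1..n. \<omega> (q k) * \<bar>q k\<bar> ^ r) / real n"
    using m(2) d2 by linarith
  have "(\<Sum>k=1..n. \<bar>order_stat n v k - \<sigma> * q k\<bar>)
      \<le> (\<Sum>k=1..n. \<bar>order_stat n v k - order_stat n (\<lambda>j. \<sigma> * z j) k\<bar> + \<sigma> * \<bar>order_stat n z k - q k\<bar>)"
  proof (intro sum_mono)
    fix k assume "k \<in> {1..n}"
    then have "order_stat n (\<lambda>j. \<sigma> * z j) k - \<sigma> * q k = \<sigma> * (order_stat n z k - q k)"
      using \<sigma> by (subst order_stat_cmult) (auto simp: right_diff_distrib)
    then have "\<bar>order_stat n (\<lambda>j. \<sigma> * z j) k - \<sigma> * q k\<bar> = \<sigma> * \<bar>order_stat n z k - q k\<bar>"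
      using \<sigma> by (simp add: abs_mult)
    then show "\<bar>order_stat n v k - \<sigma> * q k\<bar>
        \<le> \<bar>order_stat n v k - order_stat n (\<lambda>j. \<sigma> * z j) k\<bar> + \<sigma> * \<bar>order_stat n z k - q k\<bar>"
      by linarith
  qed
  also have "\<dots> \<le> (\<Sum>k=1..n. \<bar>v k - \<sigma> * z k\<bar>) + \<sigma> * (\<Sum>k=1..n. \<bar>order_stat n z k - q k\<bar>)"
    unfolding sum.distrib sum_distrib_left using sum_order_stat_diff_le by (intro add_right_mono)
  also have "\<dots> \<le> (d1 + \<sigma> * d2) * real n"
  proof -
    have "(\<Sum>k=1..n. \<bar>v k - \<sigma> * z k\<bar>) \<le> d1 * real n"
      using d1 n0 by (simp add: pos_divide_le_eq)
    moreover have "\<sigma> * (\<Sum>k=1..n. \<bar>order_stat n z k - q k\<bar>) \<le> \<sigma> * (d2 * real n)"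
      using d2(1) n0 \<sigma> by (intro mult_left_mono) (auto simp: pos_divide_le_eq)
    ultimately show ?thesis by (simp add: algebra_simps)
  qed
  finally have up: "(\<Sum>k=1..n. \<bar>order_stat n v k - \<sigma> * q k\<bar>) \<le> (d1 + \<sigma> * d2) * real n" .
  have "\<bar>s - \<sigma>\<bar> * (m / 2) * real n \<le> \<bar>s - \<sigma>\<bar> * (\<Sum>k=1..n. \<omega> (q k) * \<bar>q k\<bar> ^ r)"
    using low n0 by (simp only: pos_le_divide_eq mult.assoc) (intro mult_left_mono, auto)
  also have "\<dots> \<le> max 2 B * (\<Sum>k=1..n. \<bar>order_stat n v k - \<sigma> * q k\<bar>)"
    by (rule sum_weight_abs_le[OF r \<omega> B s])
  also have "\<dots> \<le> max 2 B * ((d1 + \<sigma> * d2) * real n)"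
    by (intro mult_left_mono up) auto
  finally have le: "\<bar>s - \<sigma>\<bar> * (m / 2) \<le> max 2 B * (d1 + \<sigma> * d2)"
    using n0 by (simp only: mult.assoc[symmetric] mult_le_cancel_right_pos)
  have "\<bar>s - \<sigma>\<bar> = \<bar>s - \<sigma>\<bar> * (m / 2) * (2 / m)"
    using m(1) by simp
  also have "\<dots> \<le> max 2 B * (d1 + \<sigma> * d2) * (2 / m)"
    using m(1) by (intro mult_right_mono le) auto
  also have "\<dots> = 2 * max 2 B / m * (d1 + \<sigma> * d2)"
    by (simp add: ac_simps)
  finally show ?thesis .
qed

section \<open>From high-probability bounds to the stochastic orders\<close>

lemma (in prob_space) tendsto_in_probI:
  assumes le: "\<And>\<epsilon>. 0 < \<epsilon> \<Longrightarrow> \<exists>K>0. mostly M \<epsilon> (\<lambda>n x. \<bar>S n x - c\<bar> \<le> K * \<beta> n)"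
    and \<beta>: "\<beta> \<longlonglongrightarrow> 0"
  shows "tendsto_in_prob M S c"
  unfolding tendsto_in_prob_def
proof (intro allI impI)
  fix e :: real assume e: "0 < e"
  show "(\<lambda>n. prob {x \<in> space M. e < \<bar>S n x - c\<bar>}) \<longlonglongrightarrow> 0"
  proof (rule order_tendstoI)
    show "\<forall>\<^sub>F n in sequentially. a < prob {x \<in> space M. e < \<bar>S n x - c\<bar>}" if "a < 0" for a
      by (intro always_eventually allI less_le_trans[OF that]) auto
    fix \<delta> :: real assume "0 < \<delta>"
    then obtain K where K: "0 < K" "mostly M (\<delta> / 2) (\<lambda>n x. \<bar>S n x - c\<bar> \<le> K * \<beta> n)"
      using le[of "\<delta> / 2"] by auto
    have "(\<lambda>n. K * \<beta> n) \<longlonglongrightarrow> K * 0" by (intro tendsto_intros \<beta>)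
    then have "\<forall>\<^sub>F n in sequentially. K * \<beta> n < e"
      using e by (intro order_tendstoD(2)) auto
    with K(2) show "\<forall>\<^sub>F n in sequentially. prob {x \<in> space M. e < \<bar>S n x - c\<bar>} < \<delta>"
      unfolding mostly_def
    proof eventually_elim
      case (elim n)
      then obtain A where A: "A \<in> sets M" "prob A \<le> \<delta> / 2" "\<forall>x\<in>space M - A. \<bar>S n x - c\<bar> \<le> K * \<beta> n"
        by blast
      have "{x \<in> space M. e < \<bar>S n x - c\<bar>} \<subseteq> A"
        using A(3) elim(2) by force
      then have "prob {x \<in> space M. e < \<bar>S n x - c\<bar>} \<le> prob A"
        using A(1) by (rule finite_measure_mono)
      with A(2) \<open>0 < \<delta>\<close> show ?case by linarith
    qed
  qed
qed

text \<open>\<open>tight\<close> asks for one interval valid for all \<open>n\<close>, whereas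
  \<open>mostly\<close> speaks of large \<open>n\<close>. The finitely many remaining laws are each
  concentrated on some bounded interval, and the symmetric intervals increase, so one of them serves
  all.\<close>

lemma (in prob_space) bigo_in_probI:
  assumes f [measurable]: "\<And>n. f n \<in> borel_measurable M" and f0: "\<And>n x. 0 \<le> f n x"
    and \<beta>: "\<And>n. 1 \<le> n \<Longrightarrow> 0 < \<beta> n"
    and le: "\<And>\<epsilon>. 0 < \<epsilon> \<Longrightarrow> \<exists>K>0. mostly M \<epsilon> (\<lambda>n x. f n x \<le> K * \<beta> n)"
  shows "bigo_in_prob M f \<beta>"
  unfolding bigo_in_prob_def tight_def
proof (intro conjI allI impI)
  define \<mu> where "\<mu> n = distr M borel (\<lambda>x. f n x / \<beta> n)" for n
  have rd: "real_distribution (\<mu> n)" for n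
    unfolding \<mu>_def by (rule real_distribution_distr) measurable
  then show "real_distribution (distr M borel (\<lambda>x. f n x / \<beta> n))" for n
    by (simp add: \<mu>_def)
  fix \<epsilon> :: real assume \<epsilon>: "0 < \<epsilon>"
  \<comment> \<open>Half of \<epsilon> leaves room for the strict inequality in
    \<open>tight\<close>.\<close>
  then obtain K where K: "0 < K" "mostly M (\<epsilon> / 2) (\<lambda>n x. f n x \<le> K * \<beta> n)"
    using le[of "\<epsilon> / 2"] by auto
  then obtain N where N: "\<And>n. N \<le> n \<Longrightarrow> \<exists>A\<in>sets M. prob A \<le> \<epsilon> / 2 \<and> (\<forall>x\<in>space M - A. f n x \<le> K * \<beta> n)"
    unfolding mostly_def eventually_sequentially by blast
  \<comment> \<open>The maximum with 1 places \<open>n = 0\<close>, where the sign of \<beta> is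
    unknown, among the finitely many exceptions.\<close>
  have "\<forall>\<^sub>F i in sequentially. \<forall>n\<in>{..<max 1 N}. 1 - \<epsilon> < measure (\<mu> n) {- real i<..real i}"
  proof (intro eventually_ball_finite ballI)
    fix n
    interpret \<mu>: real_distribution "\<mu> n" by (rule rd)
    have "(\<lambda>i. measure (\<mu> n) {- real i<..real i}) \<longlonglongrightarrow> measure (\<mu> n) (\<Union>i. {- real i<..real i})"
      by (intro \<mu>.finite_Lim_measure_incseq) (auto simp: incseq_def)
    also have "(\<Union>i. {- real i<..real i}) = space (\<mu> n)"
      by (simp add: UN_Ioc_eq_UNIV)
    finally show "\<forall>\<^sub>F i in sequentially. 1 - \<epsilon> < measure (\<mu> n) {- real i<..real i}"
      using \<epsilon> by (intro order_tendstoD(1)) (auto simp: \<mu>.prob_space[unfolded \<mu>.space_eq_univ])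
  qed auto
  moreover have "\<forall>\<^sub>F i in sequentially. K < real i"
    by (rule eventually_sequentiallyI[of "nat \<lceil>K\<rceil> + 1"]) linarith
  ultimately have "\<forall>\<^sub>F i in sequentially. (\<forall>n\<in>{..<max 1 N}. 1 - \<epsilon> < measure (\<mu> n) {- real i<..real i}) \<and> K < real i"
    by (rule eventually_conj)
  then obtain i where i: "\<And>n. n < max 1 N \<Longrightarrow> 1 - \<epsilon> < measure (\<mu> n) {- real i<..real i}" "K < real i"
    by (auto simp: eventually_sequentially)
  have "1 - \<epsilon> < measure (\<mu> n) {- real i<..real i}" for n
  proof (cases "n < max 1 N")
    case False
    then have n: "1 \<le> n" "N \<le> n" by auto
    then obtain A where A: "A \<in> sets M" "prob A \<le> \<epsilon> / 2" "\<forall>x\<in>space M - A. f n x \<le> K * \<beta> n"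
      using N by blast
    have "1 - \<epsilon> < prob (space M - A)"
      using A \<epsilon> by (simp add: prob_compl)
    also have "\<dots> \<le> prob ((\<lambda>x. f n x / \<beta> n) -` {- real i<..real i} \<inter> space M)"
    proof (rule finite_measure_mono)
      show "(\<lambda>x. f n x / \<beta> n) -` {- real i<..real i} \<inter> space M \<in> events" by measurable
      show "space M - A \<subseteq> (\<lambda>x. f n x / \<beta> n) -` {- real i<..real i} \<inter> space M"
      proof
        fix x assume x: "x \<in> space M - A"
        have "0 \<le> f n x / \<beta> n" using f0[of n x] \<beta>[OF n(1)] by simp
        moreover have "f n x / \<beta> n \<le> K" using A(3) x \<beta>[OF n(1)] by (simp add: pos_divide_le_eq)
        ultimately show "x \<in> (\<lambda>x. f n x / \<beta> n) -` {- real i<..real i} \<inter> space M"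
          using x i(2) K(1) by simp
      qed
    qed
    also have "\<dots> = measure (\<mu> n) {- real i<..real i}"
      unfolding \<mu>_def by (subst measure_distr) auto
    finally show ?thesis .
  qed (rule i(1))
  moreover have "- real i < real i" using i(2) K(1) by linarith
  ultimately show "\<exists>a b. a < b \<and> (\<forall>n. 1 - \<epsilon> < measure (distr M borel (\<lambda>x. f n x / \<beta> n)) {a<..b})"
    unfolding \<mu>_def by (intro exI[of _ "- real i"] exI[of _ "real i"] conjI allI)
qed

text \<open>The normalization contributes \<open>n powr (1 / \<alpha>)\<close> and
  \<open>mean_abs_le_powr\<close> contributes \<open>n powr (- 1 / p)\<close>, while the sums of
  p-th powers stay bounded outside a small event.\<close>

lemma (in prob_space) mostly_increment_mean_le:
  assumes T: "0 < T" and p: "1 \<le> p" and \<epsilon>: "0 < \<epsilon>"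
    and Y: "\<And>t. 0 \<le> t \<Longrightarrow> t \<le> T \<Longrightarrow> Y t \<in> borel_measurable M"
    and fin: "AE x in M. limsup (\<lambda>n. ereal (\<Sum>k=1..n.
           \<bar>Y (T * real k / real n) x - Y (T * (real k - 1) / real n) x\<bar> powr p)) < \<infinity>"
  shows "\<exists>K>0. mostly M \<epsilon> (\<lambda>n x. (\<Sum>k=1..n. \<bar>scaled_increment \<alpha> T Y n k x\<bar>) / real n
    \<le> K * real n powr (1 / \<alpha> - 1 / p))"
proof -
  define D where "D n k x = Y (T * real k / real n) x - Y (T * (real k - 1) / real n) x" for n k x
  define V where "V n x = (\<Sum>k=1..n. \<bar>D n k x\<bar> powr p)" for n x
  have V_meas: "V n \<in> borel_measurable M" for n
  proof -
    have [measurable]: "D n k \<in> borel_measurable M" if "k \<in> {1..n}" for k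
      unfolding D_def[abs_def] using that T
      by (intro borel_measurable_diff Y) (auto simp: divide_le_eq)
    show ?thesis unfolding V_def[abs_def] by measurable
  qed
  have "AE x in M. limsup (\<lambda>n. ereal (V n x)) < \<infinity>"
    unfolding V_def D_def by (rule fin)
  from mostly_bounded_if_limsup_finite[OF V_meas this \<epsilon>]
  obtain K where K: "0 < K" "mostly M \<epsilon> (\<lambda>n x. V n x \<le> K)"
    by blast
  have "(\<Sum>k=1..n. \<bar>scaled_increment \<alpha> T Y n k x\<bar>) / real n
      \<le> (T powr (- 1 / \<alpha>) * (1 + K)) * real n powr (1 / \<alpha> - 1 / p)"
    if n: "1 \<le> n" and V: "V n x \<le> K" for n x
  proof -
    have "(\<Sum>k=1..n. \<bar>scaled_increment \<alpha> T Y n k x\<bar>) / real n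
        = (T / real n) powr (- 1 / \<alpha>) * ((\<Sum>k=1..n. \<bar>D n k x\<bar>) / real n)"
      by (simp add: scaled_increment_def D_def abs_mult sum_distrib_left)
    also have "\<dots> \<le> (T / real n) powr (- 1 / \<alpha>) * (real n powr (- 1 / p) * (1 + K))"
      using V
      by (intro mult_left_mono order_trans[OF mean_abs_le_powr[OF p n]]) (auto simp: V_def)
    also have "(T / real n) powr (- 1 / \<alpha>) = T powr (- 1 / \<alpha>) * real n powr (1 / \<alpha>)"
      using T n by (simp add: powr_divide powr_minus divide_simps)
    also have "T powr (- 1 / \<alpha>) * real n powr (1 / \<alpha>) * (real n powr (- 1 / p) * (1 + K))
        = (T powr (- 1 / \<alpha>) * (1 + K)) * (real n powr (1 / \<alpha>) * real n powr (- 1 / p))"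
      by (simp only: ac_simps)
    also have "real n powr (1 / \<alpha>) * real n powr (- 1 / p) = real n powr (1 / \<alpha> - 1 / p)"
      by (simp flip: powr_add)
    finally show ?thesis .
  qed
  then have "mostly M \<epsilon> (\<lambda>n x. (\<Sum>k=1..n. \<bar>scaled_increment \<alpha> T Y n k x\<bar>) / real n
      \<le> (T powr (- 1 / \<alpha>) * (1 + K)) * real n powr (1 / \<alpha> - 1 / p))"
    by (intro mostly_mono[OF K(2)] eventually_mono[OF eventually_ge_at_top[of 1]]) blast
  moreover have "0 < T powr (- 1 / \<alpha>) * (1 + K)" using T K(1) by simp
  ultimately show ?thesis by blast
qed

section \<open>Consistency and rate of the scale estimator\<close>

theorem corollary5p2:
  fixes M :: "'a measure"
    and Y Z :: "real \<Rightarrow> 'a \<Rightarrow> real"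
    and T \<sigma> \<alpha> p :: real
    and r :: nat
    and \<Psi> \<omega> :: "real \<Rightarrow> real"
    and X \<psi> :: "nat \<Rightarrow> nat \<Rightarrow> 'a \<Rightarrow> real"
    and S :: "nat \<Rightarrow> 'a \<Rightarrow> real"
  assumes "prob_space M"
    and "T > 0" and "\<sigma> > 0"
    and "1 < \<alpha>" and "\<alpha> < 2"
    and "stable_levy_process M \<alpha> Z"
    and "self_similar M (1 / \<alpha>) Z"
    and "\<Psi> = cdf (distr M borel (Z 1))"
    and "\<And>t. 0 \<le> t \<Longrightarrow> t \<le> T \<Longrightarrow> Y t \<in> borel_measurable M"
    and "1 \<le> p" and "p < \<alpha>"
    and "AE x in M. limsup (\<lambda>n. ereal (\<Sum>k=1..n.
           \<bar>Y (T * real k / real n) x - Y (T * (real k - 1) / real n) x\<bar> powr p)) < \<infinity>"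
    and "X = scaled_increment \<alpha> T (\<lambda>t x. Y t x + \<sigma> * Z t x)"
    and "r \<in> {1, 2}"
    and "deterministic_proxy \<Psi> \<psi> \<or> random_proxy M X Z \<Psi> \<psi>"
    and "\<And>x. \<omega> x \<in> {0..1}"
    and "continuous_on UNIV \<omega>"
    and "bdd_above (range (\<lambda>x. \<bar>x\<bar> ^ (2 * r) * \<omega> x))"
    and "(\<integral>x. \<bar>Z 1 x\<bar> ^ r * \<omega> (Z 1 x) \<partial>M) > 0"
    and "scale_estimator M r \<omega> X \<psi> S"
  shows "tendsto_in_prob M S \<sigma>
    \<and> bigo_in_prob M (\<lambda>n x. \<bar>S n x - \<sigma>\<bar>) (\<lambda>n. real n powr (1 / \<alpha> - 1 / p))"
proof -
  interpret prob_space M by fact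
  define \<mu> where "\<mu> = distr M borel (Z 1)"
  define \<zeta> where "\<zeta> = scaled_increment \<alpha> T Z"
  have levy: "levy_process M Z" and stable: "stable_distribution \<alpha> \<mu>"
    using \<open>stable_levy_process M \<alpha> Z\<close> by (auto simp: stable_levy_process_def \<mu>_def)
  have Z1 [measurable]: "Z 1 \<in> borel_measurable M"
    using levy by (simp add: levy_process_def)
  have law: "real_distribution \<mu>"
    using stable by (simp add: stable_distribution_def)
  interpret \<mu>: real_distribution \<mu> by fact
  have \<Psi>: "\<Psi> = cdf \<mu>" using \<open>\<Psi> = _\<close> by (simp add: \<mu>_def)
  obtain C where C: "0 \<le> C" "\<And>x. x \<noteq> 0 \<Longrightarrow> \<mu>.prob {y. \<bar>x\<bar> \<le> \<bar>y\<bar>} \<le> C * \<bar>x\<bar> powr - \<alpha>"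
    using stable_distribution_tail[OF stable] \<open>1 < \<alpha>\<close> by auto
  \<comment> \<open>The first alternative holds on the negative half-line, the second on the
    positive one; each is one side of the two-sided stable tail.\<close>
  have tail: "cdf \<mu> x \<le> C * \<bar>x\<bar> powr - \<alpha> \<or> 1 - cdf \<mu> x \<le> C * \<bar>x\<bar> powr - \<alpha>" if "x \<noteq> 0" for x
  proof (cases "x < 0")
    case True
    have "cdf \<mu> x \<le> \<mu>.prob {y. \<bar>x\<bar> \<le> \<bar>y\<bar>}"
      unfolding cdf_def using True by (intro \<mu>.finite_measure_mono) auto
    with C(2)[OF that] show ?thesis by linarith
  next
    case False
    have "1 - cdf \<mu> x = \<mu>.prob (- {..x})"
      unfolding cdf_def using \<mu>.prob_compl[of "{..x}"] by (simp add: Compl_eq_Diff_UNIV)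
    also have "\<dots> \<le> \<mu>.prob {y. \<bar>x\<bar> \<le> \<bar>y\<bar>}"
      using False by (intro \<mu>.finite_measure_mono) auto
    finally show ?thesis using C(2)[OF that] by linarith
  qed
  have indep: "indep_vars (\<lambda>_. borel) (\<zeta> n) {1..n}" if "1 \<le> n" for n
    unfolding \<zeta>_def by (rule scaled_increment_iid(1)[OF levy \<open>self_similar M (1 / \<alpha>) Z\<close> \<open>0 < T\<close> that])
  have distr: "distr M borel (\<zeta> n k) = \<mu>" if "1 \<le> n" "k \<in> {1..n}" for n k
    unfolding \<zeta>_def \<mu>_def by (rule scaled_increment_iid(2)[OF levy \<open>self_similar M (1 / \<alpha>) Z\<close> \<open>0 < T\<close> that])
  have proxy: "deterministic_proxy (cdf \<mu>) \<psi> \<or> random_proxy M X Z (cdf \<mu>) \<psi>"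
    using \<open>deterministic_proxy \<Psi> \<psi> \<or> _\<close> by (simp only: \<Psi>)
  have cont: "continuous_on UNIV (\<lambda>x. \<bar>x\<bar> ^ r * \<omega> x)"
    using \<open>continuous_on UNIV \<omega>\<close> by (intro continuous_intros)
  have [measurable]: "(\<lambda>x. \<bar>x\<bar> ^ r * \<omega> x) \<in> borel_measurable borel"
    using cont by (rule borel_measurable_continuous_onI)
  have "(\<integral>x. \<bar>x\<bar> ^ r * \<omega> x \<partial>\<mu>) = (\<integral>x. \<bar>Z 1 x\<bar> ^ r * \<omega> (Z 1 x) \<partial>M)"
    unfolding \<mu>_def by (rule integral_distr) measurable
  then have "0 < (\<integral>x. \<bar>x\<bar> ^ r * \<omega> x \<partial>\<mu>)"
    using \<open>0 < (\<integral>x. \<bar>Z 1 x\<bar> ^ r * \<omega> (Z 1 x) \<partial>M)\<close> by simp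
  moreover have "0 \<le> \<bar>x\<bar> ^ r * \<omega> x" for x
    using \<open>\<omega> _ \<in> {0..1}\<close>[of x] by simp
  moreover have "\<bar>0\<bar> ^ r * \<omega> 0 = 0" using \<open>r \<in> {1, 2}\<close> by auto
  ultimately obtain l where l: "\<And>x. 0 \<le> l x" "\<And>x. l x \<le> \<bar>x\<bar> ^ r * \<omega> x" "\<And>x. l x \<le> 1"
      "\<And>x y. \<bar>l x - l y\<bar> \<le> \<bar>x - y\<bar>" and m: "0 < (\<integral>x. l x \<partial>\<mu>)"
    using Lipschitz_minorant[OF law cont] by blast
  have "continuous_on UNIV l"
    by (rule lipschitz_on_continuous_on[of 1]) (auto intro!: lipschitz_onI simp: dist_real_def l(4))
  then have l_meas: "l \<in> borel_measurable borel" by (rule borel_measurable_continuous_onI)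
  define m where "m = (\<integral>x. l x \<partial>\<mu>)"
  obtain B where B: "\<And>x. \<bar>x\<bar> ^ (2 * r) * \<omega> x \<le> B"
    using \<open>bdd_above (range _)\<close> by (auto simp: bdd_above_def)
  define \<beta> where "\<beta> n = real n powr (1 / \<alpha> - 1 / p)" for n
  have rate_le: "real n powr (1 / \<alpha> - 1) \<le> \<beta> n" if "1 \<le> n" for n
    unfolding \<beta>_def using that \<open>1 \<le> p\<close> by (intro powr_mono) auto
  have main: "\<exists>K>0. mostly M \<epsilon> (\<lambda>n x. \<bar>S n x - \<sigma>\<bar> \<le> K * \<beta> n)" if \<epsilon>: "0 < \<epsilon>" for \<epsilon>
  proof -
    \<comment> \<open>One quarter for each exceptional event: the increments of \<open>Y\<close>,
      the empirical law of \<zeta>, that of the proxy, and the mean of \<open>l\<close>.\<close>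
    from \<epsilon> have \<epsilon>4: "0 < \<epsilon> / 4" by simp
    obtain K1 where K1: "0 < K1" "mostly M (\<epsilon> / 4) (\<lambda>n x. (\<Sum>k=1..n. \<bar>scaled_increment \<alpha> T Y n k x\<bar>) / real n \<le> K1 * \<beta> n)"
      using mostly_increment_mean_le[OF \<open>0 < T\<close> \<open>1 \<le> p\<close> \<epsilon>4 assms(9) assms(12)] unfolding \<beta>_def by blast
    obtain K2 where K2: "0 < K2" "mostly M (\<epsilon> / 4) (\<lambda>n x. cdf_dist (ecdf n (\<lambda>k. \<zeta> n k x)) (cdf \<mu>) \<le> ennreal (K2 * real n powr (1 / \<alpha> - 1)))"
      using mostly_cdf_dist_iid[OF law tail C(1) \<open>1 < \<alpha>\<close> \<open>\<alpha> < 2\<close> \<epsilon>4 indep distr] by blast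
    obtain K3 where K3: "0 < K3" "mostly M (\<epsilon> / 4) (\<lambda>n x. cdf_dist (ecdf n (\<lambda>k. \<psi> n k x)) (cdf \<mu>) \<le> ennreal (K3 * real n powr (1 / \<alpha> - 1)))"
      using mostly_cdf_dist_proxy[OF law tail C(1) \<open>1 < \<alpha>\<close> \<open>\<alpha> < 2\<close> \<epsilon>4 proxy] by blast
    have mean: "mostly M (\<epsilon> / 4) (\<lambda>n x. \<bar>(\<Sum>k=1..n. l (\<zeta> n k x)) / real n - m\<bar> \<le> m / 4)"
      unfolding m_def
      by (rule mostly_mean_near[OF indep distr l_meas _ \<epsilon>4, where B=1]) (use l m in \<open>auto simp: abs_le_iff intro: order_trans\<close>)
    define K where "K = 2 * max 2 B / m * (K1 + \<sigma> * (K2 + K3))"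
    have "0 < K"
      unfolding K_def using m K1(1) K2(1) K3(1) \<open>0 < \<sigma>\<close>
      by (intro mult_pos_pos divide_pos_pos add_pos_pos) (auto simp: m_def)
    have "(\<lambda>n. (K2 + K3) * real n powr (1 / \<alpha> - 1)) \<longlonglongrightarrow> (K2 + K3) * 0"
      using \<open>1 < \<alpha>\<close>
      by (intro tendsto_mult tendsto_const tendsto_neg_powr filterlim_real_sequentially) auto
    then have small: "\<forall>\<^sub>F n in sequentially. (K2 + K3) * real n powr (1 / \<alpha> - 1) < m / 4"
      using m by (intro order_tendstoD(2)) (auto simp: m_def)
    have bound: "\<bar>S n x - \<sigma>\<bar> \<le> K * \<beta> n"
      if n: "1 \<le> n" and x: "x \<in> space M" and s: "(K2 + K3) * real n powr (1 / \<alpha> - 1) < m / 4"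
        and 1: "(\<Sum>k=1..n. \<bar>scaled_increment \<alpha> T Y n k x\<bar>) / real n \<le> K1 * \<beta> n"
        and 2: "cdf_dist (ecdf n (\<lambda>k. \<zeta> n k x)) (cdf \<mu>) \<le> ennreal (K2 * real n powr (1 / \<alpha> - 1))"
        and 3: "cdf_dist (ecdf n (\<lambda>k. \<psi> n k x)) (cdf \<mu>) \<le> ennreal (K3 * real n powr (1 / \<alpha> - 1))"
        and 4: "\<bar>(\<Sum>k=1..n. l (\<zeta> n k x)) / real n - m\<bar> \<le> m / 4"
      for n x
    proof -
      define d2 where "d2 = (K2 + K3) * real n powr (1 / \<alpha> - 1)"
      have meas: "cdf \<mu> \<in> borel_measurable borel"
        by (intro borel_measurable_mono monoI \<mu>.cdf_nondecreasing)
      \<comment> \<open>Both samples are monotone, so their mean distance is a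
        \<open>cdf_dist\<close>; passing through \<open>cdf \<mu>\<close> lets the increments and
        the proxy be estimated separately.\<close>
      have "ennreal ((\<Sum>k=1..n. \<bar>order_stat n (\<lambda>j. \<zeta> n j x) k - \<psi> n k x\<bar>) / real n)
          = cdf_dist (ecdf n (order_stat n (\<lambda>j. \<zeta> n j x))) (ecdf n (\<lambda>k. \<psi> n k x))"
        by (rule cdf_dist_ecdf_mono[OF mono_on_order_stat mono_on_proxy[OF law proxy n x], symmetric])
      also have "\<dots> \<le> cdf_dist (ecdf n (\<lambda>j. \<zeta> n j x)) (cdf \<mu>) + cdf_dist (ecdf n (\<lambda>k. \<psi> n k x)) (cdf \<mu>)"
        unfolding ecdf_order_stat by (intro cdf_dist_triangle ecdf_measurable meas)
      also have "\<dots> \<le> ennreal (K2 * real n powr (1 / \<alpha> - 1)) + ennreal (K3 * real n powr (1 / \<alpha> - 1))"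
        by (intro add_mono 2 3)
      also have "\<dots> = ennreal d2"
        using K2(1) K3(1) by (simp add: d2_def distrib_right flip: ennreal_plus)
      finally have d2: "(\<Sum>k=1..n. \<bar>order_stat n (\<lambda>j. \<zeta> n j x) k - \<psi> n k x\<bar>) / real n \<le> d2"
        using K2(1) K3(1) by (subst (asm) ennreal_le_iff) (auto simp: d2_def)
      have X: "X n k x - \<sigma> * \<zeta> n k x = scaled_increment \<alpha> T Y n k x" for k
        by (simp add: \<open>X = _\<close> \<zeta>_def scaled_increment_def algebra_simps)
      have "\<bar>S n x - \<sigma>\<bar> \<le> 2 * max 2 B / m * (K1 * \<beta> n + \<sigma> * d2)"
      proof (rule scale_estimator_error_le[OF n \<open>r \<in> {1, 2}\<close> \<open>\<omega> _ \<in> {0..1}\<close> B _ l(2,4) _ 4 \<open>0 < \<sigma>\<close> _ d2])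
        show "is_arg_min (scale_objective r \<omega> n (\<lambda>k. X n k x) (\<lambda>k. \<psi> n k x)) (\<lambda>_. True) (S n x)"
          using \<open>scale_estimator M r \<omega> X \<psi> S\<close> n x by (simp add: scale_estimator_def)
        show "(\<Sum>k=1..n. \<bar>X n k x - \<sigma> * \<zeta> n k x\<bar>) / real n \<le> K1 * \<beta> n"
          unfolding X by (rule 1)
      qed (use s m in \<open>auto simp: d2_def m_def\<close>)
      also have "\<dots> \<le> 2 * max 2 B / m * (K1 * \<beta> n + \<sigma> * ((K2 + K3) * \<beta> n))"
        unfolding d2_def using rate_le[OF n] K2(1) K3(1) \<open>0 < \<sigma>\<close> m
        by (intro mult_left_mono add_left_mono divide_nonneg_pos) (auto simp: m_def)
      also have "\<dots> = K * \<beta> n" by (simp add: K_def algebra_simps add_divide_distrib)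
      finally show ?thesis .
    qed
    have "mostly M (\<epsilon> / 4 + \<epsilon> / 4 + \<epsilon> / 4 + \<epsilon> / 4) (\<lambda>n x. \<bar>S n x - \<sigma>\<bar> \<le> K * \<beta> n)"
      using eventually_conj[OF eventually_ge_at_top[of 1] small]
      by (intro mostly_mono[OF mostly_conj[OF mostly_conj[OF mostly_conj[OF K1(2) K2(2)] K3(2)] mean]],
          elim eventually_mono) (blast intro: bound)
    then show ?thesis using \<open>0 < K\<close> by auto
  qed
  have S: "S n \<in> borel_measurable M" for n
    using \<open>scale_estimator M r \<omega> X \<psi> S\<close> by (simp add: scale_estimator_def)
  have "1 / \<alpha> - 1 / p < 0"
    using \<open>1 \<le> p\<close> \<open>p < \<alpha>\<close> by (simp add: field_simps)
  then have "\<beta> \<longlonglongrightarrow> 0"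
    unfolding \<beta>_def[abs_def] by (intro tendsto_neg_powr filterlim_real_sequentially)
  with main have "tendsto_in_prob M S \<sigma>"
    by (rule tendsto_in_probI)
  moreover have "bigo_in_prob M (\<lambda>n x. \<bar>S n x - \<sigma>\<bar>) \<beta>"
    using S main by (intro bigo_in_probI) (auto simp: \<beta>_def)
  ultimately show ?thesis
    unfolding \<beta>_def[abs_def] by blast
qed

end
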